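(* Let $n\ge 1$ and let $\mathbf{a}=\{a_{ij}>0: 1\le i\le j\le n+1\}$ be any vector of positive parameters. Then $\mathrm{Ass}_n^{\rm III}(\mathbf{a})$ has $n$ pairs of parallel facets. They correspond to the pairs of diagonals $(\{n+2,i\},\{0,i+1\})$, $1\le i\le n$, of the convex $(n+3)$-gon with vertices labeled $0,1,\dots,n+2$.
   Context: For $1\le i\le j\le n+1$ let $\Delta_{[i,\dots,j]}=\mathrm{conv}\{e_i,e_{i+1},\dots,e_j\}\subset\mathbb{R}^{n+1}$, and define the Minkowski sum $$\mathrm{Ass}_n^{\rm III}(\mathbf{a})=\sum_{1\le i\le j\le n+1}a_{ij}\,\Delta_{[i,\dots,j]}\subset\mathbb{R}^{n+1},$$ an $n$-dimensional polytope. Correspondence of faces with subdivisions: for a linear function $w=(w_1,\dots,w_{n+1})\in(\mathbb{R}^{n+1})^*$, let $F_w$ be the face of points of $\mathrm{Ass}_n^{\rm III}(\mathbf{a})$ maximizing $w$. Fix a convex $(n+3)$-gon with vertices labeled counterclockwise $0,1,\dots,n+2$, put $w_0=w_{n+2}=\infty$, and let $H_k=\mathrm{conv}\{i\in\{0,\dots,n+2\}: w_i\ge w_k\}$ for $k=0,\dots,n+2$. Let $S_w$ be the subdivision of the $(n+3)$-gon whose diagonals are all edges of the polygons $H_k$ that are diagonals of the $(n+3)$-gon. The map $F_w\mapsto S_w$ is an order-preserving bijection between nonempty faces (ordered by inclusion) and subdivisions without new vertices (ordered by refinement). In particular facets correspond to single diagonals: the facet corresponding to a diagonal $\delta$ is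 the face $F_w$ for which $S_w$ has $\delta$ as its only diagonal. Two facets of a polytope are parallel if they are distinct and the linear subspaces spanned by the differences of their points coincide. *)

theory Defs
  imports "HOL-Analysis.Analysis" "HOL-Library.Set_Algebras"
begin

text \<open>
  Throughout, \<open>R^(n+1)\<close> is a Euclidean space \<open>'a\<close> together with an enumeration
  \<open>e 1, \<dots>, e (n+1)\<close> of its standard basis \<open>Basis\<close>.  A linear function on it is given by its
  coordinates \<open>w 1, \<dots>, w (n+1)\<close>; other values of \<open>w\<close> are never used.
\<close>

definition simplex_interval :: "(nat \<Rightarrow> 'a::euclidean_space) \<Rightarrow> nat \<Rightarrow> nat \<Rightarrow> 'a set" where
  "simplex_interval e i j = convex hull (e ` {i..j})"

text \<open>The sum below is the Minkowski sum of sets of \<open>Set_Algebras\<close>.\<close>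

definition assIII ::
    "nat \<Rightarrow> (nat \<Rightarrow> 'a::euclidean_space) \<Rightarrow> (nat \<Rightarrow> nat \<Rightarrow> real) \<Rightarrow> 'a set" where
  "assIII n e a =
     (\<Sum>(i, j)\<in>{(i, j). 1 \<le> i \<and> i \<le> j \<and> j \<le> n + 1}.
        (\<lambda>x. a i j *\<^sub>R x) ` simplex_interval e i j)"

definition linear_fun ::
    "nat \<Rightarrow> (nat \<Rightarrow> 'a::euclidean_space) \<Rightarrow> (nat \<Rightarrow> real) \<Rightarrow> 'a \<Rightarrow> real" where
  "linear_fun n e w x = (\<Sum>i = 1..n + 1. w i * (x \<bullet> e i))"

definition max_face ::
    "nat \<Rightarrow> (nat \<Rightarrow> 'a::euclidean_space) \<Rightarrow> 'a set \<Rightarrow> (nat \<Rightarrow> real) \<Rightarrow> 'a set" where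
  "max_face n e P w = {x \<in> P. \<forall>y\<in>P. linear_fun n e w y \<le> linear_fun n e w x}"

text \<open>
  A convex \<open>(n+3)\<close>-gon in the plane with vertices \<open>p 0, \<dots>, p (n+2)\<close> in counterclockwise order:
  the triangle on any three vertices, taken in the order of their labels, is positively oriented
  (and hence nondegenerate).
\<close>

definition convex_polygon_ccw :: "nat \<Rightarrow> (nat \<Rightarrow> complex) \<Rightarrow> bool" where
  "convex_polygon_ccw n p \<longleftrightarrow>
     (\<forall>i j k. i < j \<and> j < k \<and> k \<le> n + 2 \<longrightarrow> Im (cnj (p j - p i) * (p k - p i)) > 0)"

text \<open>A diagonal is represented by the set of labels of its two (non-adjacent) end points.\<close>

definition diagonals :: "nat \<Rightarrow> nat set set" where
  "diagonals n = {{i, j} |i j. i + 1 < j \<and> j \<le> n + 2 \<and> (i, j) \<noteq> (0, n + 2)}"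

definition ext_weight :: "nat \<Rightarrow> (nat \<Rightarrow> real) \<Rightarrow> nat \<Rightarrow> ereal" where
  "ext_weight n w k = (if k = 0 \<or> k = n + 2 then \<infinity> else ereal (w k))"

definition level_polygon :: "nat \<Rightarrow> (nat \<Rightarrow> complex) \<Rightarrow> (nat \<Rightarrow> real) \<Rightarrow> nat \<Rightarrow> complex set" where
  "level_polygon n p w k =
     convex hull (p ` {i \<in> {0..n + 2}. ext_weight n w i \<ge> ext_weight n w k})"

text \<open>
  The subdivision \<open>S\<^sub>w\<close>, given by its set of diagonals.  If a polygon \<open>H\<^sub>k\<close> degenerates to a
  segment (as \<open>H\<^sub>0\<close> always does), that segment counts as its edge; it is then the side with end
  points \<open>0\<close> and \<open>n+2\<close>, so not a diagonal.
\<close>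

definition subdivision :: "nat \<Rightarrow> (nat \<Rightarrow> complex) \<Rightarrow> (nat \<Rightarrow> real) \<Rightarrow> nat set set" where
  "subdivision n p w =
     {d \<in> diagonals n. \<exists>k \<in> {0..n + 2}. (convex hull (p ` d)) edge_of (level_polygon n p w k)}"

definition diagonal_facet ::
    "nat \<Rightarrow> (nat \<Rightarrow> 'a::euclidean_space) \<Rightarrow> (nat \<Rightarrow> nat \<Rightarrow> real) \<Rightarrow> (nat \<Rightarrow> complex)
      \<Rightarrow> nat set \<Rightarrow> 'a set" where
  "diagonal_facet n e a p d =
     (THE F. \<exists>w. F = max_face n e (assIII n e a) w \<and> subdivision n p w = {d})"

definition parallel_facets :: "'a::euclidean_space set \<Rightarrow> 'a set \<Rightarrow> 'a set \<Rightarrow> bool" where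
  "parallel_facets P F G \<longleftrightarrow>
     F facet_of P \<and> G facet_of P \<and> F \<noteq> G \<and>
     span {x - y |x y. x \<in> F \<and> y \<in> F} = span {x - y |x y. x \<in> G \<and> y \<in> G}"

definition parallel_facet_pairs :: "'a::euclidean_space set \<Rightarrow> 'a set set set" where
  "parallel_facet_pairs P = {{F, G} |F G. parallel_facets P F G}"

end

theory Submission
  imports Defs
begin

text \<open>
  Let \<open>P\<close> be the polytope.  For an interval \<open>I = {l..m}\<close> of indices, the sum of the coordinates
  in \<open>I\<close> is minimal on \<open>P\<close> exactly at those sums of points of the simplices in which every simplex
  that is not contained in the coordinate subspace of \<open>I\<close> contributes a point without mass in
  \<open>I\<close>; the minimum is the total weight of the simplices that are contained in that subspace.
  Call this face the interval face of \<open>I\<close>.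

  The direction space of an interval face consists of the vectors whose coordinates sum to zero on
  \<open>I\<close> and on its complement (\<open>directions_interval_face\<close>): vectors \<open>e r - e s\<close> with \<open>r, s\<close> in the
  same part are realised by moving along an edge of one simplex.  Counting dimensions, interval
  faces of proper intervals are facets.  Conversely every facet is one of them
  (\<open>facet_is_interval_face\<close>): a facet maximizes some weight vector, and it lies in the interval
  face of a maximal run of indices with minimal weight, because a simplex reaching beyond the run
  has a vertex of larger weight next to it.

  The direction space of an interval face remembers exactly the partition of the indices into \<open>I\<close>
  and its complement.  So two facets are parallel if and only if they belong to complementary
  intervals, and two proper intervals are complementary only if they are \<open>{1..i}\<close> and
  \<open>{i + 1..n + 1}\<close> for some \<open>i\<close> from \<open>1\<close> to \<open>n\<close>.

  It remains to match facets with diagonals.  For a proper interval, the diagonal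
  \<open>{l - 1, m + 1}\<close> cuts off the vertices \<open>l, \<dots>, m\<close> of the polygon.  It is the only diagonal of the subdivision of a weight exactly if
  the weight takes one value on \<open>{l..m}\<close> and one larger value elsewhere
  (\<open>subdivision_two_valued\<close> and \<open>single_diagonal_two_valued\<close>), and the face of such a weight is the
  interval face of \<open>{l..m}\<close>.
\<close>

section \<open>Edges of the level polygons\<close>

text \<open>
  Twice the signed area of the triangle \<open>u, v, x\<close>; its sign tells on which side of the line
  through \<open>u\<close> and \<open>v\<close> the point \<open>x\<close> lies.
\<close>
definition orient :: "complex \<Rightarrow> complex \<Rightarrow> complex \<Rightarrow> real" where
  "orient u v x = Im (cnj (v - u) * (x - u))"

lemma orient_cyclic: "orient u v x = orient v x u"
  by (simp add: orient_def algebra_simps)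

lemma orient_swap: "orient u v x = - orient u x v"
  by (simp add: orient_def algebra_simps)

text \<open>
  As a function of \<open>x\<close>, the signed area is affine with normal vector \<open>\<i> (v - u)\<close>.  This turns
  sign conditions on \<open>orient\<close> into supporting half-planes.
\<close>
lemma orient_eq_inner: "orient u v x = (\<i> * (v - u)) \<bullet> x - (\<i> * (v - u)) \<bullet> u"
  by (simp add: orient_def inner_complex_def algebra_simps)

lemma orient_on_segment:
  assumes "z \<in> closed_segment u v"
  shows "orient u v z = 0"
proof -
  obtain t where z: "z = (1 - t) *\<^sub>R u + t *\<^sub>R v"
    using assms by (auto simp: closed_segment_def)
  show ?thesis unfolding z by (simp add: orient_def algebra_simps)
qed

lemma orient_degenerate [simp]: "orient u u x = 0" "orient u v u = 0" "orient u v v = 0"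
  by (simp_all add: orient_def algebra_simps)

lemma weighted_mean_convex_form:
  fixes u v :: "'v::real_vector" and s t :: real
  assumes "s + t > 0"
  shows "(1 / (s + t)) *\<^sub>R (s *\<^sub>R u + t *\<^sub>R v) = (1 - t / (s + t)) *\<^sub>R u + (t / (s + t)) *\<^sub>R v"
proof -
  have "1 - t / (s + t) = s / (s + t)" using assms by (simp add: field_simps)
  then show ?thesis by (simp add: scaleR_add_right)
qed

text \<open>
  The two diagonals of a convex quadrilateral meet in their interiors: any four points of the plane
  satisfy an affine dependence whose coefficients are the signed areas of the four triangles, and
  here all these areas are positive, so the dependence equates a weighted mean of \<open>a, c\<close> with
  one of \<open>b, d\<close>.
\<close>
lemma diagonals_cross:
  assumes "orient a b c > 0" "orient a b d > 0" "orient a c d > 0" "orient b c d > 0"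
  shows "\<exists>x. x \<in> open_segment a c \<and> x \<in> open_segment b d"
proof -
  let ?s = "orient b c d + orient a b d"
  have eq: "orient b c d *\<^sub>R a + orient a b d *\<^sub>R c = orient a c d *\<^sub>R b + orient a b c *\<^sub>R d"
    by (simp add: orient_def complex_eq_iff algebra_simps)
  have s: "?s = orient a c d + orient a b c"
    by (simp add: orient_def algebra_simps)
  have "?s > 0" using assms by simp
  define x where "x = (1 / ?s) *\<^sub>R (orient b c d *\<^sub>R a + orient a b d *\<^sub>R c)"
  have ne: "a \<noteq> c" "b \<noteq> d" using assms by auto
  have "x = (1 - orient a b d / ?s) *\<^sub>R a + (orient a b d / ?s) *\<^sub>R c"
    unfolding x_def using \<open>?s > 0\<close> by (rule weighted_mean_convex_form)
  moreover have "0 < orient a b d / ?s" "orient a b d / ?s < 1"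
    using assms by (auto simp: field_simps add_pos_pos)
  ultimately have 1: "x \<in> open_segment a c"
    using ne unfolding in_segment by blast
  have "x = (1 - orient a b c / ?s) *\<^sub>R b + (orient a b c / ?s) *\<^sub>R d"
    unfolding x_def eq s using \<open>?s > 0\<close> unfolding s by (rule weighted_mean_convex_form)
  moreover have "0 < orient a b c / ?s" "orient a b c / ?s < 1"
    using assms \<open>?s > 0\<close> unfolding s by (auto simp: field_simps add_pos_pos)
  ultimately have "x \<in> open_segment b d"
    using ne unfolding in_segment by blast
  with 1 show ?thesis by blast
qed

lemma convex_polygon_orient:
  assumes "convex_polygon_ccw n p" "i < j" "j < k" "k \<le> n + 2"
  shows "orient (p i) (p j) (p k) > 0"
  using assms by (auto simp: convex_polygon_ccw_def orient_def)

text \<open>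
  There is a third vertex, and if two vertices coincided, the triangle which they form with it would
  have area zero.
\<close>
lemma convex_polygon_inj:
  assumes p: "convex_polygon_ccw n p" and "n \<ge> 1"
  shows "inj_on p {0..n + 2}"
proof -
  have *: "p i \<noteq> p j" if ij: "i < j" "j \<le> n + 2" for i j
  proof
    assume eq: "p i = p j"
    obtain k where k: "k \<le> n + 2" "k \<noteq> i" "k \<noteq> j"
    proof -
      have "\<exists>k \<in> {0,1,2::nat}. k \<noteq> i \<and> k \<noteq> j" by auto
      then show ?thesis using that by force
    qed
    consider "k < i" | "i < k" "k < j" | "j < k" using k by linarith
    then show False
      using convex_polygon_orient[OF p, of k i j] convex_polygon_orient[OF p, of i k j]
        convex_polygon_orient[OF p, of i j k] ij k eq
      by cases auto
  qed
  show ?thesis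
  proof (rule inj_onI)
    fix i j assume "i \<in> {0..n+2}" "j \<in> {0..n+2}" "p i = p j"
    then show "i = j" using *[of i j] *[of j i] by (cases i j rule: linorder_cases) auto
  qed
qed

text \<open>
  If some \<open>k\<close> in \<open>S\<close> lies strictly between \<open>i\<close> and \<open>j\<close>, then one of \<open>p 0\<close> and \<open>p (n + 2)\<close> lies
  on the other side of the line through \<open>p i\<close> and \<open>p j\<close>.  The segment from it to \<open>p k\<close> crosses the
  segment from \<open>p i\<close> to \<open>p j\<close>, so the latter is not a face.  If there is no such \<open>k\<close>, the line
  supports the hull and meets it in that segment only.
\<close>
lemma edge_of_hull_iff:
  assumes p: "convex_polygon_ccw n p" and n: "n \<ge> 1"
    and S: "S \<subseteq> {0..n + 2}" "0 \<in> S" "n + 2 \<in> S"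
    and ij: "i < j" "j \<le> n + 2" "(i, j) \<noteq> (0, n + 2)"
  shows "(convex hull (p ` {i, j})) edge_of (convex hull (p ` S)) \<longleftrightarrow>
           i \<in> S \<and> j \<in> S \<and> S \<inter> {i<..<j} = {}"
proof
  note ori = convex_polygon_orient[OF p]
  have inj: "inj_on p {0..n + 2}" by (rule convex_polygon_inj[OF p n])
  have finS: "finite S" using S(1) finite_subset by blast
  {
    assume "(convex hull (p ` {i, j})) edge_of (convex hull (p ` S))"
    then have face: "convex hull {p i, p j} face_of convex hull (p ` S)"
      by (simp add: edge_of_def)
    have ext: "k \<in> S" if k: "k \<in> {i, j}" for k
    proof -
      have "p k extreme_point_of convex hull {p i, p j}"
        using k by (auto simp: extreme_point_of_segment segment_convex_hull[symmetric])
      then have "p k extreme_point_of convex hull (p ` S)"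
        using face extreme_point_of_face by blast
      then obtain k' where k': "k' \<in> S" "p k = p k'"
        using extreme_point_of_convex_hull by blast
      moreover have "k \<in> {0..n + 2}" using k ij by auto
      ultimately show "k \<in> S" using inj_onD[OF inj k'(2)] S(1) by auto
    qed
    have cross: False
      if "k \<in> S" "k' \<in> S" "x \<in> open_segment (p i) (p j)" "x \<in> open_segment (p k) (p k')"
        "orient (p i) (p j) (p k) \<noteq> 0" for k k' x
    proof -
      have "x \<in> convex hull {p i, p j}"
        using that(3) by (auto simp: segment_convex_hull[symmetric] open_segment_def)
      moreover have "p k \<in> convex hull (p ` S)" "p k' \<in> convex hull (p ` S)"
        using that by (auto intro: hull_inc)
      ultimately have "p k \<in> convex hull {p i, p j}"
        using face that(4) unfolding face_of_def by blast
      then show False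
        using orient_on_segment that(5) by (simp add: segment_convex_hull[symmetric])
    qed
    have "S \<inter> {i<..<j} = {}"
    proof (rule ccontr)
      assume "S \<inter> {i<..<j} \<noteq> {}"
      then obtain k where k: "k \<in> S" "i < k" "k < j" by auto
      have nz: "orient (p i) (p j) (p k) \<noteq> 0"
        using ori[of i k j] k ij orient_swap[of "p i" "p j" "p k"] by simp
      \<comment> \<open>As \<open>(i, j)\<close> is not \<open>(0, n + 2)\<close>, one of the vertices \<open>0\<close> and \<open>n + 2\<close> is not an end point.\<close>
      consider "0 < i" | "j < n + 2" using ij by fastforce
      then show False
      proof cases
        case 1
        obtain x where "x \<in> open_segment (p 0) (p k)" "x \<in> open_segment (p i) (p j)"
          using diagonals_cross[of "p 0" "p i" "p k" "p j"] ori[of 0 i k] ori[of 0 i j]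
            ori[of 0 k j] ori[of i k j] 1 k ij by auto
        then show False using cross[OF k(1) S(2) _ _ nz] by (metis open_segment_commute)
      next
        case 2
        obtain x where "x \<in> open_segment (p i) (p j)" "x \<in> open_segment (p k) (p (n + 2))"
          using diagonals_cross[of "p i" "p k" "p j" "p (n + 2)"] ori[of i k j] ori[of i k "n + 2"]
            ori[of i j "n + 2"] ori[of k j "n + 2"] 2 k ij by auto
        then show False using cross[OF k(1) S(3) _ _ nz] by blast
      qed
    qed
    with ext show "i \<in> S \<and> j \<in> S \<and> S \<inter> {i<..<j} = {}" by blast
  }
  assume R: "i \<in> S \<and> j \<in> S \<and> S \<inter> {i<..<j} = {}"
  define v where "v = \<i> * (p j - p i)"
  have out: "orient (p i) (p j) (p k) > 0" if k: "k \<in> S" "k \<noteq> i" "k \<noteq> j" for k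
  proof -
    have "k < i \<or> j < k" using R k by (metis IntI emptyE greaterThanLessThan_iff linorder_neqE_nat)
    moreover have "k \<le> n + 2" using k S by auto
    ultimately show ?thesis
      using ori[of k i j] ori[of i j k] ij orient_cyclic[of "p k" "p i" "p j"] by auto
  qed
  have zero: "orient (p i) (p j) (p i) = 0" "orient (p i) (p j) (p j) = 0"
    by simp_all
  have "convex hull (p ` S) \<subseteq> {x. v \<bullet> x \<ge> v \<bullet> p i}"
  proof (rule hull_minimal)
    show "p ` S \<subseteq> {x. v \<bullet> x \<ge> v \<bullet> p i}"
    proof clarify
      fix k assume "k \<in> S"
      then have "orient (p i) (p j) (p k) \<ge> 0" using out[of k] zero by force
      then show "v \<bullet> p i \<le> v \<bullet> p k" by (simp add: orient_eq_inner v_def)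
    qed
  qed (simp add: convex_halfspace_ge)
  then have face: "(convex hull (p ` S) \<inter> {x. v \<bullet> x = v \<bullet> p i}) face_of convex hull (p ` S)"
    by (intro face_of_Int_supporting_hyperplane_ge) auto
  then obtain s' where s': "s' \<subseteq> p ` S"
      "convex hull (p ` S) \<inter> {x. v \<bullet> x = v \<bullet> p i} = convex hull s'"
    using face_of_convex_hull_subset finS by (metis finite_imageI finite_imp_compact)
  have "s' \<subseteq> {p i, p j}"
  proof
    fix y assume y: "y \<in> s'"
    then obtain k where k: "k \<in> S" "y = p k" using s' by auto
    have "y \<in> convex hull s'" using y by (rule hull_inc)
    then have "v \<bullet> y = v \<bullet> p i" using s'(2) by blast
    then have "orient (p i) (p j) (p k) = 0" using k by (simp add: orient_eq_inner v_def)
    then show "y \<in> {p i, p j}" using out[of k] k by fastforce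
  qed
  moreover have "{p i, p j} \<subseteq> convex hull s'"
  proof -
    have "v \<bullet> p j = v \<bullet> p i" using zero(2) unfolding orient_eq_inner v_def by linarith
    then show ?thesis unfolding s'(2)[symmetric] using R by (auto intro: hull_inc)
  qed
  ultimately have "convex hull s' = convex hull {p i, p j}"
    by (meson convex_convex_hull hull_minimal hull_mono subset_antisym)
  then have "convex hull {p i, p j} face_of convex hull (p ` S)" using face s'(2) by simp
  moreover have "aff_dim (convex hull {p i, p j}) = 1"
  proof -
    have "p i \<noteq> p j" using inj_onD[OF inj, of i j] ij by auto
    then show ?thesis by (simp add: aff_dim_convex_hull)
  qed
  ultimately show "(convex hull (p ` {i, j})) edge_of (convex hull (p ` S))"
    by (simp add: edge_of_def)
qed

definition level_vertices :: "nat \<Rightarrow> (nat \<Rightarrow> real) \<Rightarrow> nat \<Rightarrow> nat set" where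
  "level_vertices n w k = {i \<in> {0..n + 2}. ext_weight n w i \<ge> ext_weight n w k}"

lemma level_vertices_ends: "0 \<in> level_vertices n w k" "n + 2 \<in> level_vertices n w k"
  by (auto simp: level_vertices_def ext_weight_def)

lemma level_vertices_infinite: "k = 0 \<or> k = n + 2 \<Longrightarrow> level_vertices n w k = {0, n + 2}"
  by (auto simp: level_vertices_def ext_weight_def)

lemma mem_level_vertices:
  assumes "k \<in> {1..n + 1}" "i \<in> {1..n + 1}"
  shows "i \<in> level_vertices n w k \<longleftrightarrow> w k \<le> w i"
  using assms by (auto simp: level_vertices_def ext_weight_def)

text \<open>
  The levels \<open>k = 0\<close> and \<open>k = n + 2\<close> may be left out: their polygon is the side from \<open>0\<close> to
  \<open>n + 2\<close>.
\<close>
lemma subdivision_iff: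
  assumes p: "convex_polygon_ccw n p" and n: "n \<ge> 1"
    and ij: "i + 1 < j" "j \<le> n + 2" "(i, j) \<noteq> (0, n + 2)"
  shows "{i, j} \<in> subdivision n p w \<longleftrightarrow>
    (\<exists>k \<in> {1..n + 1}. i \<in> level_vertices n w k \<and> j \<in> level_vertices n w k \<and> level_vertices n w k \<inter> {i<..<j} = {})"
    (is "_ \<longleftrightarrow> (\<exists>k \<in> {1..n + 1}. ?Q k)")
proof -
  have "{i, j} \<in> diagonals n" using ij unfolding diagonals_def by blast
  moreover have "(convex hull (p ` {i, j})) edge_of (level_polygon n p w k) \<longleftrightarrow> ?Q k" for k
    unfolding level_polygon_def level_vertices_def[symmetric]
    using ij by (intro edge_of_hull_iff[OF p n]) (auto simp: level_vertices_ends level_vertices_def ext_weight_def)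
  ultimately have "{i, j} \<in> subdivision n p w \<longleftrightarrow> (\<exists>k \<in> {0..n + 2}. ?Q k)"
    by (simp add: subdivision_def)
  also have "\<dots> \<longleftrightarrow> (\<exists>k \<in> {1..n + 1}. ?Q k)"
  proof
    assume "\<exists>k \<in> {0..n + 2}. ?Q k"
    then obtain k where k: "k \<in> {0..n + 2}" "?Q k" by blast
    have "k \<noteq> 0 \<and> k \<noteq> n + 2"
    proof (rule ccontr)
      assume "\<not> (k \<noteq> 0 \<and> k \<noteq> n + 2)"
      then have "level_vertices n w k = {0, n + 2}" using level_vertices_infinite[of k n w] by auto
      then show False using k(2) ij by auto
    qed
    then show "\<exists>k \<in> {1..n + 1}. ?Q k" using k by (intro bexI[of _ k]) auto
  qed auto
  finally show ?thesis .
qed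

text \<open>
  The last vertex of the level polygon before \<open>q\<close> and the first one after \<open>q\<close> are consecutive, so
  they are joined by an edge.  This edge is a diagonal: \<open>q\<close> lies between its end points, and it is
  not the side from \<open>0\<close> to \<open>n + 2\<close> because \<open>k\<close> itself is a vertex of the level polygon.
\<close>
lemma level_vertices_gap:
  assumes p: "convex_polygon_ccw n p" and n: "n \<ge> 1"
    and k: "k \<in> {1..n + 1}" and q: "q \<in> {0..n + 2}" "q \<notin> level_vertices n w k"
  obtains i j where "{i, j} \<in> subdivision n p w" "i < q" "q < j" "level_vertices n w k \<inter> {i<..<j} = {}"
proof -
  let ?V = "level_vertices n w k"
  have fin: "finite ?V" by (simp add: level_vertices_def)
  have q0: "0 < q" "q < n + 2" using q level_vertices_ends[of n w k] by (auto simp: le_less intro: gr0I)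
  define i where "i = Max (?V \<inter> {..<q})"
  define j where "j = Min (?V \<inter> {q<..})"
  have i: "i \<in> ?V \<inter> {..<q}" unfolding i_def
    using fin q0 level_vertices_ends(1)[of n w k] by (intro Max_in) auto
  have j: "j \<in> ?V \<inter> {q<..}" unfolding j_def
    using fin q0 level_vertices_ends(2)[of n w k] by (intro Min_in) auto
  have gap: "?V \<inter> {i<..<j} = {}"
  proof (rule ccontr)
    assume "?V \<inter> {i<..<j} \<noteq> {}"
    then obtain z where z: "z \<in> ?V" "i < z" "z < j" by auto
    have "z \<noteq> q" using z q by auto
    then consider "z < q" | "q < z" by linarith
    then show False
    proof cases
      case 1 then have "z \<le> i" unfolding i_def using fin z by (intro Max_ge) auto
      then show False using z by simp
    next
      case 2 then have "j \<le> z" unfolding j_def using fin z by (intro Min_le) auto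
      then show False using z by simp
    qed
  qed
  have "k \<in> ?V" using k by (auto simp: mem_level_vertices)
  then have "(i, j) \<noteq> (0, n + 2)" using gap k by auto
  then have "{i, j} \<in> subdivision n p w"
    using i j gap k by (subst subdivision_iff[OF p n]) (auto simp: level_vertices_def)
  then show ?thesis using that i j gap by auto
qed

text \<open>
  Apart from the full polygon and the side from \<open>0\<close> to \<open>n + 2\<close>, the only level polygon is that of
  the larger value, which is obtained by cutting off the vertices in the interval.
\<close>
lemma subdivision_two_valued:
  assumes p: "convex_polygon_ccw n p" and n: "n \<ge> 1"
    and lm: "1 \<le> l" "l \<le> m" "m \<le> n + 1" "(l, m) \<noteq> (1, n + 1)"
    and w: "\<And>k. k \<in> {l..m} \<Longrightarrow> w k = s" "\<And>k. k \<in> {1..n + 1} - {l..m} \<Longrightarrow> w k = t" "s < t"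
  shows "subdivision n p w = {{l - 1, m + 1}}"
proof -
  have lev: "level_vertices n w k = (if k \<in> {l..m} then {0..n + 2} else {0..n + 2} - {l..m})"
    if k: "k \<in> {1..n + 1}" for k
  proof (rule set_eqI)
    fix i
    consider "i = 0 \<or> i = n + 2" | "1 \<le> i \<and> i \<le> n + 1" | "i > n + 2" by linarith
    then show "i \<in> level_vertices n w k \<longleftrightarrow>
        i \<in> (if k \<in> {l..m} then {0..n + 2} else {0..n + 2} - {l..m})"
    proof cases
      case 1
      then show ?thesis using level_vertices_ends[of n w k] lm by auto
    next
      case 2
      then have i: "i \<in> {1..n + 1}" by simp
      have val: "w q = (if q \<in> {l..m} then s else t)" if "q \<in> {1..n + 1}" for q
        using w(1)[of q] w(2)[of q] that by (cases "q \<in> {l..m}") simp_all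
      have "i \<in> {0..n + 2}" using 2 by simp
      then show ?thesis
        using mem_level_vertices[OF k i, of w] val[OF k] val[OF i] w(3)
        by (cases "k \<in> {l..m}"; cases "i \<in> {l..m}") (simp_all del: atLeastAtMost_iff)
    next
      case 3
      then show ?thesis by (auto simp: level_vertices_def)
    qed
  qed
  have lev_in: "level_vertices n w k = {0..n + 2}" if "k \<in> {1..n + 1}" "k \<in> {l..m}" for k
    unfolding lev[OF that(1)] by (rule if_P[OF that(2)])
  have lev_out: "level_vertices n w k = {0..n + 2} - {l..m}" if "k \<in> {1..n + 1}" "k \<notin> {l..m}" for k
    unfolding lev[OF that(1)] by (rule if_not_P[OF that(2)])
  have main: "{i, j} \<in> subdivision n p w \<longleftrightarrow> (i, j) = (l - 1, m + 1)"
    if ij: "i + 1 < j" "j \<le> n + 2" "(i, j) \<noteq> (0, n + 2)" for i j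
  proof
    assume "{i, j} \<in> subdivision n p w"
    then obtain k where k: "k \<in> {1..n + 1}" "i \<in> level_vertices n w k" "j \<in> level_vertices n w k"
        "level_vertices n w k \<inter> {i<..<j} = {}"
      using subdivision_iff[OF p n ij] by blast
    have i1: "i + 1 \<notin> level_vertices n w k" "j - 1 \<notin> level_vertices n w k" using k(4) ij by auto
    have "k \<notin> {l..m}"
    proof
      assume "k \<in> {l..m}"
      then have "level_vertices n w k = {0..n + 2}" by (rule lev_in[OF k(1)])
      moreover have "i + 1 \<in> {0..n + 2}" using ij by simp
      ultimately show False using i1(1) by blast
    qed
    then have L: "level_vertices n w k = {0..n + 2} - {l..m}" by (rule lev_out[OF k(1)])
    have "i + 1 \<in> {0..n + 2}" "j - 1 \<in> {0..n + 2}" using ij by simp_all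
    then have "i + 1 \<in> {l..m}" "j - 1 \<in> {l..m}" using i1 L by blast+
    moreover have "i \<notin> {l..m}" "j \<notin> {l..m}" using k(2,3) L by blast+
    ultimately show "(i, j) = (l - 1, m + 1)" by auto
  next
    assume eq: "(i, j) = (l - 1, m + 1)"
    obtain k where k: "k \<in> {1..n + 1}" "k \<notin> {l..m}"
    proof -
      have "1 \<notin> {l..m} \<or> n + 1 \<notin> {l..m}" using lm by auto
      then show ?thesis using that[of 1] that[of "n + 1"] by auto
    qed
    then have "level_vertices n w k = {0..n + 2} - {l..m}" by (rule lev_out)
    then have "i \<in> level_vertices n w k \<and> j \<in> level_vertices n w k \<and> level_vertices n w k \<inter> {i<..<j} = {}"
      using eq lm by auto
    then show "{i, j} \<in> subdivision n p w"
      unfolding subdivision_iff[OF p n ij] using k(1) by (intro bexI[of _ k])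
  qed
  show ?thesis
  proof (rule set_eqI)
    fix d
    show "d \<in> subdivision n p w \<longleftrightarrow> d \<in> {{l - 1, m + 1}}"
    proof
      assume d: "d \<in> subdivision n p w"
      then obtain i j where "d = {i, j}" "i + 1 < j" "j \<le> n + 2" "(i, j) \<noteq> (0, n + 2)"
        unfolding subdivision_def diagonals_def by blast
      then show "d \<in> {{l - 1, m + 1}}" using main[of i j] d by auto
    next
      assume "d \<in> {{l - 1, m + 1}}"
      then show "d \<in> subdivision n p w" using main[of "l - 1" "m + 1"] lm by auto
    qed
  qed
qed

text \<open>
  By \<open>level_vertices_gap\<close>, every vertex missing from a level polygon \<open>H\<^sub>k\<close> with \<open>1 \<le> k \<le> n + 1\<close> is
  cut off by a diagonal that is an edge of \<open>H\<^sub>k\<close>.  As there is a single diagonal, \<open>H\<^sub>k\<close> is either the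
  whole polygon or misses exactly the vertices from \<open>l\<close> to \<open>m\<close>.  So there are two levels.
\<close>
lemma single_diagonal_two_valued:
  assumes p: "convex_polygon_ccw n p" and n: "n \<ge> 1"
    and lm: "1 \<le> l" "l \<le> m" "m \<le> n + 1" "(l, m) \<noteq> (1, n + 1)"
    and sub: "subdivision n p w = {{l - 1, m + 1}}"
  obtains s t where "\<And>k. k \<in> {l..m} \<Longrightarrow> w k = s"
    "\<And>k. k \<in> {1..n + 1} - {l..m} \<Longrightarrow> w k = t" "s < t"
proof -
  let ?V = "level_vertices n w"
  have gap: "q \<in> {l..m} \<and> ?V k \<inter> {l..m} = {}"
    if kq: "k \<in> {1..n + 1}" "q \<in> {0..n + 2}" "q \<notin> ?V k" for k q
  proof -
    obtain i j where ij: "{i, j} \<in> subdivision n p w" "i < q" "q < j" "?V k \<inter> {i<..<j} = {}"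
      using level_vertices_gap[OF p n kq] by blast
    then have "i = l - 1 \<and> j = m + 1" using sub lm by (auto simp: doubleton_eq_iff)
    then have "{i<..<j} = {l..m}" using lm by auto
    then show ?thesis using ij by (metis greaterThanLessThan_iff)
  qed
  have "{l - 1, m + 1} \<in> subdivision n p w" using sub by simp
  then obtain k0 where k0: "k0 \<in> {1..n + 1}" "?V k0 \<inter> {l - 1<..<m + 1} = {}"
    using lm by (subst (asm) subdivision_iff[OF p n]) auto
  have k0': "?V k0 \<inter> {l..m} = {}"
  proof -
    have "{l - 1<..<m + 1} = {l..m}" using lm by auto
    then show ?thesis using k0 by simp
  qed
  have k0_min: "w k0 \<le> w k" if "k \<in> {1..n + 1} - {l..m}" for k
    using gap[OF k0(1), of k] that mem_level_vertices[OF k0(1), of k] by auto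
  have I_min: "w k \<le> w q" if "k \<in> {l..m}" "q \<in> {1..n + 1}" for k q
  proof (rule ccontr)
    have k: "k \<in> {1..n + 1}" using that lm by auto
    assume "\<not> w k \<le> w q"
    then have "q \<notin> ?V k" using mem_level_vertices[OF k that(2)] by simp
    moreover have "k \<in> ?V k" using mem_level_vertices[OF k k] by simp
    ultimately show False using gap[OF k, of q] that by auto
  qed
  have "l \<in> {l..m}" and l: "l \<in> {1..n + 1}" using lm by simp_all
  then have "l \<notin> ?V k0" using k0' by blast
  then have less: "w l < w k0" using mem_level_vertices[OF k0(1) l, of w] by simp
  have O_min: "w k \<le> w q" if "k \<in> {1..n + 1} - {l..m}" "q \<in> {1..n + 1} - {l..m}" for k q
  proof -
    have "l \<notin> ?V k"
      using mem_level_vertices[of k n l w] that lm less k0_min[OF that(1)] by auto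
    moreover have "q \<in> ?V k" using gap[of k q] that by auto
    ultimately show ?thesis using mem_level_vertices[of k n q w] that by auto
  qed
  have "k0 \<in> ?V k0" using mem_level_vertices[OF k0(1) k0(1), of w] by simp
  then have "k0 \<notin> {l..m}" using k0' by blast
  show ?thesis
  proof (rule that[of "w l" "w k0"])
    show "w k = w l" if "k \<in> {l..m}" for k
      using I_min[of k l] I_min[of l k] that lm by auto
    show "w k = w k0" if "k \<in> {1..n + 1} - {l..m}" for k
      using O_min[of k k0] O_min[of k0 k] that k0(1) \<open>k0 \<notin> {l..m}\<close> by (auto intro: antisym)
  qed (rule less)
qed

section \<open>Dimension and direction space\<close>

lemma aff_dim_eq_dim_differences:
  fixes S :: "'a::euclidean_space set"
  assumes "S \<noteq> {}"
  shows "aff_dim S = int (dim (span {x - y |x y. x \<in> S \<and> y \<in> S}))"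
proof -
  obtain c where c: "c \<in> S" using assms by blast
  let ?T = "(\<lambda>x. x - c) ` S"
  let ?D = "{x - y |x y. x \<in> S \<and> y \<in> S}"
  have "?D \<subseteq> span ?T"
  proof clarify
    fix x y assume "x \<in> S" "y \<in> S"
    then have "(x - c) - (y - c) \<in> span ?T" by (intro span_diff span_base) auto
    then show "x - y \<in> span ?T" by simp
  qed
  moreover have "?T \<subseteq> span ?D" using c by (auto intro!: span_base)
  ultimately have "span ?D = span ?T" by (simp add: span_eq)
  moreover have "aff_dim S = int (dim ?T)"
    using c by (intro aff_dim_eq_dim_subtract hull_inc)
  ultimately show ?thesis by (metis dim_span)
qed

text \<open>
  Facets are maximal among the proper faces, by dimension.
\<close>
lemma facets_subset_eq:
  fixes P :: "'a::euclidean_space set"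
  assumes "convex P" "F facet_of P" "G facet_of P" "F \<subseteq> G"
  shows "F = G"
proof (rule ccontr)
  assume "F \<noteq> G"
  moreover have "F face_of G"
    using assms face_of_subset[of F P G] by (auto simp: facet_of_def face_of_imp_subset)
  moreover have "convex G" using assms(3) by (auto simp: facet_of_def face_of_def)
  ultimately have "aff_dim F < aff_dim G" by (intro face_of_aff_dim_lt)
  then show False using assms(2,3) by (simp add: facet_of_def)
qed

section \<open>The polytope and its interval faces\<close>

locale minkowski_associahedron =
  fixes n :: nat and e :: "nat \<Rightarrow> 'a::euclidean_space" and a :: "nat \<Rightarrow> nat \<Rightarrow> real"
  assumes e_bij: "bij_betw e {1..n + 1} Basis"
    and a_pos: "\<And>i j. 1 \<le> i \<Longrightarrow> i \<le> j \<Longrightarrow> j \<le> n + 1 \<Longrightarrow> a i j > 0"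
begin

abbreviation P :: "'a set" where
  "P \<equiv> assIII n e a"

definition summands :: "(nat \<times> nat) set" where
  "summands = {(i, j). 1 \<le> i \<and> i \<le> j \<and> j \<le> n + 1}"

definition coord_sum :: "nat set \<Rightarrow> 'a \<Rightarrow> real" where
  "coord_sum I x = (\<Sum>k\<in>I. x \<bullet> e k)"

text \<open>
  For a set \<open>I\<close> of indices this is the minimum of \<open>coord_sum I\<close> over the polytope: see
  \<open>interval_mass_le\<close> and, for intervals, \<open>interval_face_nonempty\<close>.
\<close>
definition interval_mass :: "nat set \<Rightarrow> real" where
  "interval_mass I = (\<Sum>(i, j)\<in>{(i, j)\<in>summands. {i..j} \<subseteq> I}. a i j)"

definition interval_face :: "nat \<Rightarrow> nat \<Rightarrow> 'a set" where
  "interval_face l m = {x \<in> P. coord_sum {l..m} x = interval_mass {l..m}}"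

abbreviation valid_interval :: "nat \<Rightarrow> nat \<Rightarrow> bool" where
  "valid_interval l m \<equiv> 1 \<le> l \<and> l \<le> m \<and> m \<le> n + 1"

abbreviation proper_interval :: "nat \<Rightarrow> nat \<Rightarrow> bool" where
  "proper_interval l m \<equiv> valid_interval l m \<and> (l, m) \<noteq> (1, n + 1)"

lemma finite_summands: "finite summands"
  by (rule finite_subset[of _ "{1..n + 1} \<times> {1..n + 1}"]) (auto simp: summands_def)

lemma inner_e:
  assumes "i \<in> {1..n + 1}" "j \<in> {1..n + 1}"
  shows "e i \<bullet> e j = (if i = j then 1 else 0)"
  using assms bij_betwE[OF e_bij] inj_on_eq_iff[OF bij_betw_imp_inj_on[OF e_bij]]
  by (simp add: inner_Basis del: atLeastAtMost_iff)

lemma expansion: "(\<Sum>k\<in>{1..n + 1}. (x \<bullet> e k) *\<^sub>R e k) = x"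
  using sum.reindex_bij_betw[OF e_bij, of "\<lambda>b. (x \<bullet> b) *\<^sub>R b"] by (simp add: euclidean_representation)

lemma linear_fun_eq_inner: "linear_fun n e (\<lambda>k. c \<bullet> e k) x = c \<bullet> x"
  using sum.reindex_bij_betw[OF e_bij, of "\<lambda>b. (c \<bullet> b) * (x \<bullet> b)"]
  by (simp add: linear_fun_def euclidean_inner[of c x])

lemma coord_sum_inner: "coord_sum I x = (\<Sum>k\<in>I. e k) \<bullet> x"
  unfolding coord_sum_def inner_sum_left by (rule sum.cong) (simp_all add: inner_commute)

lemma coord_sum_linear:
  "coord_sum I (x - y) = coord_sum I x - coord_sum I y"
  "coord_sum I (c *\<^sub>R x) = c * coord_sum I x"
  "coord_sum I (\<Sum>t\<in>T. f t) = (\<Sum>t\<in>T. coord_sum I (f t))"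
  by (simp_all add: coord_sum_inner inner_diff_right inner_sum_right)

lemma coord_sum_e:
  assumes "I \<subseteq> {1..n + 1}" "k \<in> {1..n + 1}"
  shows "coord_sum I (e k) = (if k \<in> I then 1 else 0)"
proof -
  have "finite I" using assms finite_subset by blast
  have "coord_sum I (e k) = (\<Sum>j\<in>I. if k = j then 1 else 0)"
    unfolding coord_sum_def using assms by (intro sum.cong) (auto simp: inner_e simp del: atLeastAtMost_iff)
  then show ?thesis using \<open>finite I\<close> by simp
qed

lemma simplex_coords:
  assumes ij: "(i, j) \<in> summands" and y: "y \<in> simplex_interval e i j"
  shows "k \<in> {1..n + 1} \<Longrightarrow> y \<bullet> e k \<ge> 0"
    and "k \<in> {1..n + 1} \<Longrightarrow> k \<notin> {i..j} \<Longrightarrow> y \<bullet> e k = 0"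
    and "coord_sum {i..j} y = 1"
proof -
  have sub: "{i..j} \<subseteq> {1..n + 1}" using ij by (auto simp: summands_def)
  have H: "y \<in> convex hull (e ` {i..j})" using y by (simp add: simplex_interval_def)
  show "y \<bullet> e k \<ge> 0" if k: "k \<in> {1..n + 1}"
  proof -
    have "convex hull (e ` {i..j}) \<subseteq> {x. e k \<bullet> x \<ge> 0}"
    proof (rule hull_minimal)
      show "e ` {i..j} \<subseteq> {x. e k \<bullet> x \<ge> 0}"
      proof clarify
        fix q assume "q \<in> {i..j}"
        then show "e k \<bullet> e q \<ge> 0" using inner_e[OF k, of q] sub by auto
      qed
    qed (rule convex_halfspace_ge)
    then show ?thesis using H by (auto simp: inner_commute)
  qed
  show "y \<bullet> e k = 0" if k: "k \<in> {1..n + 1}" "k \<notin> {i..j}"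
  proof -
    have "convex hull (e ` {i..j}) \<subseteq> {x. e k \<bullet> x = 0}"
    proof (rule hull_minimal)
      show "e ` {i..j} \<subseteq> {x. e k \<bullet> x = 0}"
      proof clarify
        fix q assume "q \<in> {i..j}"
        then show "e k \<bullet> e q = 0" using inner_e[OF k(1), of q] sub k(2) by auto
      qed
    qed (rule convex_hyperplane)
    then show ?thesis using H by (auto simp: inner_commute)
  qed
  have "convex hull (e ` {i..j}) \<subseteq> {x. (\<Sum>k\<in>{i..j}. e k) \<bullet> x = 1}"
  proof (rule hull_minimal)
    show "e ` {i..j} \<subseteq> {x. (\<Sum>k\<in>{i..j}. e k) \<bullet> x = 1}"
    proof clarify
      fix q assume q: "q \<in> {i..j}"
      then have "coord_sum {i..j} (e q) = 1" using coord_sum_e[OF sub, of q] sub by auto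
      then show "(\<Sum>k\<in>{i..j}. e k) \<bullet> e q = 1" by (simp add: coord_sum_inner)
    qed
  qed (rule convex_hyperplane)
  then show "coord_sum {i..j} y = 1" using H by (auto simp: coord_sum_inner)
qed

lemma simplex_coord_sum_nonneg:
  assumes "(i, j) \<in> summands" "y \<in> simplex_interval e i j" "I \<subseteq> {1..n + 1}"
  shows "coord_sum I y \<ge> 0"
  unfolding coord_sum_def using simplex_coords(1)[OF assms(1,2)] assms(3) by (intro sum_nonneg) blast

lemma simplex_coord_sum_superset:
  assumes "(i, j) \<in> summands" "y \<in> simplex_interval e i j" "I \<subseteq> {1..n + 1}" "{i..j} \<subseteq> I"
  shows "coord_sum I y = 1"
proof -
  have "finite I" using assms(3) finite_subset by blast
  then have "coord_sum I y = coord_sum {i..j} y"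
    unfolding coord_sum_def using simplex_coords(2)[OF assms(1,2)] assms(3,4)
    by (intro sum.mono_neutral_right) auto
  then show ?thesis using simplex_coords(3)[OF assms(1,2)] by simp
qed

lemma e_in_simplex: "k \<in> {i..j} \<Longrightarrow> e k \<in> simplex_interval e i j"
  by (auto simp: simplex_interval_def intro: hull_inc)

definition is_selection :: "(nat \<times> nat \<Rightarrow> 'a) \<Rightarrow> bool" where
  "is_selection y \<longleftrightarrow> (\<forall>(i, j)\<in>summands. y (i, j) \<in> simplex_interval e i j)"

definition point_of :: "(nat \<times> nat \<Rightarrow> 'a) \<Rightarrow> 'a" where
  "point_of y = (\<Sum>(i, j)\<in>summands. a i j *\<^sub>R y (i, j))"

lemma P_eq: "P = {point_of y |y. is_selection y}"
proof -
  let ?S = "\<lambda>(i, j). (\<lambda>x. a i j *\<^sub>R x) ` simplex_interval e i j"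
  have "P = {sum s summands |s. \<forall>t\<in>summands. s t \<in> ?S t}"
    unfolding assIII_def summands_def[symmetric] by (rule set_sum_alt[OF finite_summands])
  also have "\<dots> = {point_of y |y. is_selection y}"
  proof safe
    fix s assume s: "\<forall>t\<in>summands. s t \<in> ?S t"
    then have "\<forall>t\<in>summands. \<exists>z. z \<in> simplex_interval e (fst t) (snd t) \<and> s t = a (fst t) (snd t) *\<^sub>R z"
      by fastforce
    then obtain y where y: "\<forall>t\<in>summands. y t \<in> simplex_interval e (fst t) (snd t) \<and>
        s t = a (fst t) (snd t) *\<^sub>R y t"
      by metis
    have "sum s summands = point_of y"
      unfolding point_of_def by (rule sum.cong) (use y in auto)
    moreover have "is_selection y" using y by (auto simp: is_selection_def)
    ultimately show "\<exists>y. sum s summands = point_of y \<and> is_selection y" by blast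
  next
    fix y assume "is_selection y"
    then show "\<exists>s. point_of y = sum s summands \<and> (\<forall>t\<in>summands. s t \<in> ?S t)"
      by (intro exI[of _ "\<lambda>(i, j). a i j *\<^sub>R y (i, j)"]) (auto simp: point_of_def is_selection_def)
  qed
  finally show ?thesis .
qed

lemma polytope_P: "polytope P"
proof -
  let ?V = "\<lambda>(i, j). (\<lambda>x. a i j *\<^sub>R x) ` e ` {i..j}"
  have "P = (\<Sum>t\<in>summands. convex hull (?V t))"
    unfolding assIII_def summands_def[symmetric]
    by (rule sum.cong) (auto simp: simplex_interval_def convex_hull_scaling)
  also have "\<dots> = convex hull (\<Sum>t\<in>summands. ?V t)" by (rule convex_hull_set_sum[symmetric])
  finally show ?thesis unfolding polytope_def
    by (intro exI[of _ "\<Sum>t\<in>summands. ?V t"] conjI) (auto intro!: finite_set_sum)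
qed

lemma coord_sum_point_of:
  "coord_sum I (point_of y) = (\<Sum>(i, j)\<in>summands. a i j * coord_sum I (y (i, j)))"
  by (simp add: point_of_def coord_sum_linear case_prod_unfold)

lemma interval_mass_eq:
  "interval_mass I = (\<Sum>(i, j)\<in>summands. a i j * (if {i..j} \<subseteq> I then 1 else 0))"
  unfolding interval_mass_def
  by (rule sum.mono_neutral_cong_left) (auto simp: finite_summands subset_iff split: if_splits)

text \<open>
  A simplex inside the coordinate subspace of \<open>I\<close> has \<open>coord_sum I\<close> identically one, and any
  other simplex at least contributes a nonnegative amount.
\<close>
lemma interval_mass_le:
  assumes "x \<in> P" "I \<subseteq> {1..n + 1}"
  shows "interval_mass I \<le> coord_sum I x"
proof -
  obtain y where y: "x = point_of y" "is_selection y" using assms(1) P_eq by blast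
  have "a i j * (if {i..j} \<subseteq> I then 1 else 0) \<le> a i j * coord_sum I (y (i, j))"
    if ij: "(i, j) \<in> summands" for i j
  proof -
    have "y (i, j) \<in> simplex_interval e i j" using y(2) ij by (auto simp: is_selection_def)
    then have "(if {i..j} \<subseteq> I then 1 else 0) \<le> coord_sum I (y (i, j))"
      using simplex_coord_sum_superset[OF ij] simplex_coord_sum_nonneg[OF ij] assms(2)
      by (auto simp del: atLeastatMost_subset_iff)
    moreover have "a i j > 0" using a_pos ij by (auto simp: summands_def)
    ultimately show ?thesis by (intro mult_left_mono) auto
  qed
  then show ?thesis
    unfolding y(1) coord_sum_point_of interval_mass_eq by (intro sum_mono) auto
qed

text \<open>
  Only the simplices inside the coordinate subspace of \<open>I\<close> contribute, and each of them does so
  with its full weight.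
\<close>
lemma coord_sum_eq_mass:
  assumes y: "is_selection y" and I: "I \<subseteq> {1..n + 1}"
    and z: "\<And>i j. (i, j) \<in> summands \<Longrightarrow> \<not> {i..j} \<subseteq> I \<Longrightarrow> coord_sum I (y (i, j)) = 0"
  shows "coord_sum I (point_of y) = interval_mass I"
  unfolding coord_sum_point_of interval_mass_eq
proof (rule sum.cong[OF refl], clarify)
  fix i j assume ij: "(i, j) \<in> summands"
  then have "y (i, j) \<in> simplex_interval e i j" using y by (auto simp: is_selection_def)
  then show "a i j * coord_sum I (y (i, j)) = a i j * (if {i..j} \<subseteq> I then 1 else 0)"
    using z[OF ij] simplex_coord_sum_superset[OF ij _ I] by (auto simp del: atLeastatMost_subset_iff)
qed

text \<open>
  Each simplex lies in the hyperplane of coordinate sum one.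
\<close>
lemma total_coord_sum:
  assumes "x \<in> P"
  shows "coord_sum {1..n + 1} x = interval_mass {1..n + 1}"
proof -
  obtain y where y: "x = point_of y" "is_selection y" using assms P_eq by blast
  show ?thesis unfolding y(1)
    by (rule coord_sum_eq_mass[OF y(2) order_refl]) (auto simp: summands_def)
qed

lemma interval_face_total: "interval_face 1 (n + 1) = P"
  using total_coord_sum by (auto simp: interval_face_def)

lemma vertex_point_in_interval_face:
  assumes "valid_interval l m"
    and f: "\<And>i j. (i, j) \<in> summands \<Longrightarrow> f (i, j) \<in> {i..j}"
      "\<And>i j. (i, j) \<in> summands \<Longrightarrow> \<not> {i..j} \<subseteq> {l..m} \<Longrightarrow> f (i, j) \<notin> {l..m}"
  shows "point_of (\<lambda>t. e (f t)) \<in> interval_face l m"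
proof -
  have sel: "is_selection (\<lambda>t. e (f t))"
    using f(1) e_in_simplex by (auto simp: is_selection_def simp del: atLeastAtMost_iff)
  have I: "{l..m} \<subseteq> {1..n + 1}" using assms(1) by auto
  have "coord_sum {l..m} (e (f (i, j))) = 0" if "(i, j) \<in> summands" "\<not> {i..j} \<subseteq> {l..m}" for i j
  proof -
    have "f (i, j) \<in> {1..n + 1}" using f(1)[OF that(1)] that(1) by (auto simp: summands_def)
    then show ?thesis using coord_sum_e[OF I] f(2)[OF that] by simp
  qed
  then have "coord_sum {l..m} (point_of (\<lambda>t. e (f t))) = interval_mass {l..m}"
    by (rule coord_sum_eq_mass[OF sel I])
  moreover have "point_of (\<lambda>t. e (f t)) \<in> P" using sel P_eq by blast
  ultimately show ?thesis by (simp add: interval_face_def)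
qed

text \<open>
  A choice of vertices whose weighted sum lies in the interval face.  On simplices spanned inside the
  interval the choice is arbitrary.
\<close>
definition avoiding :: "nat \<Rightarrow> nat \<Rightarrow> nat \<times> nat \<Rightarrow> nat" where
  "avoiding l m = (\<lambda>(i, j). if {i..j} \<subseteq> {l..m} then i else SOME k. k \<in> {i..j} - {l..m})"

lemma avoiding:
  assumes "(i, j) \<in> summands"
  shows "avoiding l m (i, j) \<in> {i..j}"
    and "\<not> {i..j} \<subseteq> {l..m} \<Longrightarrow> avoiding l m (i, j) \<notin> {l..m}"
proof -
  have *: "(SOME k. k \<in> {i..j} - {l..m}) \<in> {i..j} - {l..m}" if "\<not> {i..j} \<subseteq> {l..m}"
    by (rule someI_ex) (use that in blast)
  show "\<not> {i..j} \<subseteq> {l..m} \<Longrightarrow> avoiding l m (i, j) \<notin> {l..m}"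
    using * unfolding avoiding_def by simp
  show "avoiding l m (i, j) \<in> {i..j}"
  proof (cases "{i..j} \<subseteq> {l..m}")
    case True then show ?thesis using assms unfolding avoiding_def by (simp add: summands_def)
  next
    case False then show ?thesis using *[OF False] unfolding avoiding_def by simp
  qed
qed

lemma interval_face_nonempty:
  assumes "valid_interval l m"
  shows "interval_face l m \<noteq> {}"
proof -
  have "point_of (\<lambda>t. e (avoiding l m t)) \<in> interval_face l m"
    by (rule vertex_point_in_interval_face[OF assms]) (rule avoiding, assumption+)+
  then show ?thesis by blast
qed

abbreviation directions :: "'a set \<Rightarrow> 'a set" where
  "directions F \<equiv> span {x - y |x y. x \<in> F \<and> y \<in> F}"

text \<open>
  Exchanging the vertex \<open>e r\<close> for \<open>e s\<close> in the single summand \<open>\<Delta>\<^bsub>[r,\<dots>,s]\<^esub>\<close> keeps the point in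
  the face: if \<open>r\<close> and \<open>s\<close> lie in the interval, so does all of \<open>r, \<dots>, s\<close>, and any vertex
  of that simplex is allowed; if neither does, both vertices avoid the interval.  This is where the
  positivity of the parameter of that summand enters.
\<close>
lemma edge_direction:
  assumes lm: "valid_interval l m" and rs: "r < s" "r \<in> {1..n + 1}" "s \<in> {1..n + 1}"
    and same: "r \<in> {l..m} \<longleftrightarrow> s \<in> {l..m}"
  shows "e r - e s \<in> directions (interval_face l m)"
proof -
  have rsT: "(r, s) \<in> summands" using rs by (auto simp: summands_def)
  have pos: "a r s > 0" using a_pos rs by auto
  let ?f = "\<lambda>q. (avoiding l m)((r, s) := q)"
  have sub: "\<not> {r..s} \<subseteq> {l..m} \<Longrightarrow> q \<in> {r, s} \<Longrightarrow> q \<notin> {l..m}" for q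
    using same by auto
  have F: "point_of (\<lambda>t. e (?f q t)) \<in> interval_face l m" if q: "q \<in> {r, s}" for q
  proof (rule vertex_point_in_interval_face[OF lm])
    fix i j assume ij: "(i, j) \<in> summands"
    show "?f q (i, j) \<in> {i..j}" using avoiding(1)[OF ij] q rs(1) by auto
    show "\<not> {i..j} \<subseteq> {l..m} \<Longrightarrow> ?f q (i, j) \<notin> {l..m}"
      using avoiding(2)[OF ij] sub[OF _ q] by (cases "(i, j) = (r, s)") auto
  qed
  have "point_of (\<lambda>t. e (?f r t)) - point_of (\<lambda>t. e (?f s t)) =
      (\<Sum>t\<in>summands. if t = (r, s) then a r s *\<^sub>R (e r - e s) else 0)"
    unfolding point_of_def sum_subtractf[symmetric]
    by (rule sum.cong) (auto simp: scaleR_diff_right split: if_splits)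
  also have "\<dots> = a r s *\<^sub>R (e r - e s)" using rsT finite_summands by simp
  finally have diff: "point_of (\<lambda>t. e (?f r t)) - point_of (\<lambda>t. e (?f s t)) = a r s *\<^sub>R (e r - e s)" .
  have "point_of (\<lambda>t. e (?f r t)) - point_of (\<lambda>t. e (?f s t)) \<in> directions (interval_face l m)"
    by (rule span_base, rule CollectI, intro exI conjI, rule refl) (rule F, simp)+
  then have "a r s *\<^sub>R (e r - e s) \<in> directions (interval_face l m)"
    unfolding diff .
  then have "(1 / a r s) *\<^sub>R (a r s *\<^sub>R (e r - e s)) \<in> directions (interval_face l m)"
    by (rule span_mul)
  then show ?thesis using pos by simp
qed

text \<open>
  Both functionals are constant on the face, which gives one inclusion.  For the other, a vector with
  coordinate sum zero on the interval and on its complement is a combination of differences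
  \<open>e r - e s\<close> with both indices in the same part.
\<close>
lemma directions_interval_face:
  assumes lm: "valid_interval l m"
  shows "directions (interval_face l m) = {x. coord_sum {l..m} x = 0 \<and> coord_sum {1..n + 1} x = 0}"
    (is "?L = ?R")
proof
  have I: "{l..m} \<subseteq> {1..n + 1}" using lm by auto
  have "subspace ?R"
    by (auto simp: subspace_def coord_sum_inner inner_add_right)
  moreover have "{x - y |x y. x \<in> interval_face l m \<and> y \<in> interval_face l m} \<subseteq> ?R"
    using total_coord_sum by (auto simp: coord_sum_linear interval_face_def)
  ultimately show "?L \<subseteq> ?R" by (rule span_minimal[rotated])
  have dir: "e r - e s \<in> ?L" if "r \<in> {1..n + 1}" "s \<in> {1..n + 1}" "r \<in> {l..m} \<longleftrightarrow> s \<in> {l..m}" for r s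
  proof (cases r s rule: linorder_cases)
    case less
    then show ?thesis using edge_direction[OF lm _ that] by blast
  next
    case equal
    then show ?thesis by (simp add: span_zero)
  next
    case greater
    then have "e s - e r \<in> ?L" using edge_direction[OF lm _ that(2,1)] that(3) by blast
    then have "- (e s - e r) \<in> ?L" by (rule span_neg)
    then show ?thesis by simp
  qed
  show "?R \<subseteq> ?L"
  proof clarify
    fix x assume x: "coord_sum {l..m} x = 0" "coord_sum {1..n + 1} x = 0"
    define J where "J = {1..n + 1} - {l..m}"
    have xJ: "coord_sum J x = 0"
      using x sum.subset_diff[OF I, of "\<lambda>k. x \<bullet> e k"] by (simp add: coord_sum_def J_def)
    have part: "(\<Sum>k\<in>K. (x \<bullet> e k) *\<^sub>R e k) \<in> ?L"
      if K: "K \<subseteq> {1..n + 1}" "\<And>k k'. k \<in> K \<Longrightarrow> k' \<in> K \<Longrightarrow> k \<in> {l..m} \<longleftrightarrow> k' \<in> {l..m}"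
        "coord_sum K x = 0" for K
    proof (cases "K = {}")
      case False
      \<comment> \<open>Subtracting a multiple of \<open>e c\<close> costs nothing, as the coordinates in \<open>K\<close> sum to zero.\<close>
      then obtain c where c: "c \<in> K" by blast
      have "(\<Sum>k\<in>K. (x \<bullet> e k) *\<^sub>R (e k - e c)) =
          (\<Sum>k\<in>K. (x \<bullet> e k) *\<^sub>R e k) - (\<Sum>k\<in>K. x \<bullet> e k) *\<^sub>R e c"
        by (simp add: scaleR_diff_right sum_subtractf scaleR_left.sum)
      also have "\<dots> = (\<Sum>k\<in>K. (x \<bullet> e k) *\<^sub>R e k)" using K(3) by (simp add: coord_sum_def)
      finally have eq: "(\<Sum>k\<in>K. (x \<bullet> e k) *\<^sub>R e k) = (\<Sum>k\<in>K. (x \<bullet> e k) *\<^sub>R (e k - e c))" ..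
      show ?thesis unfolding eq
      proof (rule span_sum, rule span_mul)
        fix k assume k: "k \<in> K"
        show "e k - e c \<in> ?L" using dir[of k c] K(1) K(2)[OF k c] k c by blast
      qed
    qed (simp add: span_zero)
    have split: "(\<Sum>k\<in>J. (x \<bullet> e k) *\<^sub>R e k) + (\<Sum>k\<in>{l..m}. (x \<bullet> e k) *\<^sub>R e k) = x"
      using sum.subset_diff[OF I, of "\<lambda>k. (x \<bullet> e k) *\<^sub>R e k"] expansion[of x] by (simp add: J_def)
    have "(\<Sum>k\<in>J. (x \<bullet> e k) *\<^sub>R e k) \<in> ?L"
      using xJ by (intro part) (auto simp: J_def)
    moreover have "(\<Sum>k\<in>{l..m}. (x \<bullet> e k) *\<^sub>R e k) \<in> ?L"
      using x(1) I by (intro part) auto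
    ultimately have "(\<Sum>k\<in>J. (x \<bullet> e k) *\<^sub>R e k) + (\<Sum>k\<in>{l..m}. (x \<bullet> e k) *\<^sub>R e k) \<in> ?L"
      by (rule span_add)
    then show "x \<in> ?L" unfolding split .
  qed
qed

text \<open>
  The direction space is the orthogonal complement of the indicator vectors of the interval and of
  \<open>{1..n + 1}\<close>, which are linearly independent unless they coincide.  The full interval gives the
  polytope itself.
\<close>
lemma aff_dim_interval_face:
  assumes lm: "valid_interval l m"
  shows "aff_dim (interval_face l m) = int n + 1 - (if (l, m) = (1, n + 1) then 1 else 2)"
proof -
  let ?u = "\<Sum>k\<in>{l..m}. e k" and ?v = "\<Sum>k\<in>{1..n + 1}. e k"
  let ?A = "span {?u, ?v}"
  have I: "{l..m} \<subseteq> {1..n + 1}" using lm by auto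
  have uv: "?u \<bullet> e q = (if q \<in> {l..m} then 1 else 0)" "?v \<bullet> e q = 1" if "q \<in> {1..n + 1}" for q
    using coord_sum_e[OF I that] coord_sum_e[OF order_refl that] that by (simp_all add: coord_sum_inner)
  have "directions (interval_face l m) = {y \<in> UNIV. \<forall>x\<in>?A. orthogonal x y}"
    unfolding directions_interval_face[OF lm]
  proof (rule set_eqI, rule iffI)
    fix y assume "y \<in> {x. coord_sum {l..m} x = 0 \<and> coord_sum {1..n + 1} x = 0}"
    then have "orthogonal y z" if "z \<in> {?u, ?v}" for z
      using that by (auto simp: orthogonal_def coord_sum_inner inner_commute)
    then show "y \<in> {y \<in> UNIV. \<forall>x\<in>?A. orthogonal x y}"
      using orthogonal_to_span orthogonal_commute by blast
  next
    fix y assume "y \<in> {y \<in> UNIV. \<forall>x\<in>?A. orthogonal x y}"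
    then have "orthogonal ?u y" "orthogonal ?v y" by (auto intro: span_base)
    then show "y \<in> {x. coord_sum {l..m} x = 0 \<and> coord_sum {1..n + 1} x = 0}"
      by (simp add: orthogonal_def coord_sum_inner)
  qed
  then have "dim (directions (interval_face l m)) + dim ?A = DIM('a)"
    using dim_subspace_orthogonal_to_vectors[OF subspace_span subspace_UNIV, of "{?u, ?v}"] by simp
  moreover have "DIM('a) = n + 1"
    using bij_betw_same_card[OF e_bij] by simp
  moreover have "dim ?A = (if (l, m) = (1, n + 1) then 1 else 2)"
  proof (cases "(l, m) = (1, n + 1)")
    case True
    then have "?u = ?v" by simp
    moreover have "?v \<noteq> 0" using uv(2)[of 1] by auto
    ultimately show ?thesis using True by (simp add: dim_insert)
  next
    case False
    have l: "l \<in> {1..n + 1}" "l \<in> {l..m}" using lm by auto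
    obtain q where q: "q \<in> {1..n + 1}" "q \<notin> {l..m}"
    proof -
      have "1 \<notin> {l..m} \<or> n + 1 \<notin> {l..m}" using lm False by auto
      then show ?thesis using that[of 1] that[of "n + 1"] by auto
    qed
    have "?v \<noteq> 0" using uv(2)[of 1] by auto
    moreover have "?u \<notin> span {?v}"
    proof
      assume "?u \<in> span {?v}"
      then obtain c where c: "?u = c *\<^sub>R ?v" by (auto simp: span_singleton)
      have "?u \<bullet> e q = c * (?v \<bullet> e q)" "?u \<bullet> e l = c * (?v \<bullet> e l)"
        unfolding c by (rule inner_scaleR_left)+
      then show False
        unfolding uv(2)[OF l(1)] uv(2)[OF q(1)] uv(1)[OF l(1)] uv(1)[OF q(1)]
          if_P[OF l(2)] if_not_P[OF q(2)]
        by simp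
    qed
    ultimately show ?thesis using False by (auto simp: dim_insert)
  qed
  ultimately have "dim (directions (interval_face l m)) = n + 1 - (if (l, m) = (1, n + 1) then 1 else 2)"
    by simp
  moreover have "(if (l, m) = (1, n + 1) then 1 else 2) \<le> n + 1"
    using lm by auto
  ultimately show ?thesis
    using aff_dim_eq_dim_differences[OF interval_face_nonempty[OF lm]] by simp
qed

lemma interval_face_facet:
  assumes "proper_interval l m"
  shows "interval_face l m facet_of P"
proof -
  have "{l..m} \<subseteq> {1..n + 1}" using assms by auto
  then have "\<And>x. x \<in> P \<Longrightarrow> (\<Sum>k\<in>{l..m}. e k) \<bullet> x \<ge> interval_mass {l..m}"
    using interval_mass_le by (simp add: coord_sum_inner)
  then have "(P \<inter> {x. (\<Sum>k\<in>{l..m}. e k) \<bullet> x = interval_mass {l..m}}) face_of P"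
    using polytope_P by (intro face_of_Int_supporting_hyperplane_ge) (auto simp: polytope_imp_convex)
  moreover have "interval_face l m = P \<inter> {x. (\<Sum>k\<in>{l..m}. e k) \<bullet> x = interval_mass {l..m}}"
    by (auto simp: interval_face_def coord_sum_inner)
  ultimately have "interval_face l m face_of P" by (simp only:)
  moreover have "aff_dim (interval_face l m) = int n - 1"
    using aff_dim_interval_face[of l m] assms by auto
  moreover have "aff_dim P = int n"
    using aff_dim_interval_face[of 1 "n + 1", unfolded interval_face_total] by simp
  ultimately show ?thesis using interval_face_nonempty assms by (simp add: facet_of_def)
qed

section \<open>Classification of the facets\<close>

text \<open>
  Maximizing a linear function over a Minkowski sum means maximizing it over each summand:
  otherwise replacing the point of one summand would increase the value.
\<close>
lemma max_face_selection:
  assumes y: "is_selection y" and max: "\<forall>z\<in>P. c \<bullet> z \<le> c \<bullet> point_of y"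
    and ij: "(i, j) \<in> summands" and q: "q \<in> {i..j}"
  shows "c \<bullet> e q \<le> c \<bullet> y (i, j)"
proof -
  let ?y = "y((i, j) := e q)"
  have "is_selection ?y"
    using y q e_in_simplex by (auto simp: is_selection_def simp del: atLeastAtMost_iff)
  then have "c \<bullet> point_of ?y \<le> c \<bullet> point_of y" using max P_eq by blast
  then have "c \<bullet> (point_of ?y - point_of y) \<le> 0" by (simp add: inner_diff_right)
  moreover have "point_of ?y - point_of y = (\<Sum>t\<in>summands. if t = (i, j) then a i j *\<^sub>R (e q - y (i, j)) else 0)"
    unfolding point_of_def sum_subtractf[symmetric]
    by (rule sum.cong) (auto simp: scaleR_diff_right split: if_splits)
  then have "point_of ?y - point_of y = a i j *\<^sub>R (e q - y (i, j))"
    using ij finite_summands by simp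
  moreover have "a i j > 0" using a_pos ij by (auto simp: summands_def)
  ultimately have "c \<bullet> (e q - y (i, j)) \<le> 0" by (simp add: mult_le_0_iff)
  then show ?thesis by (simp add: inner_diff_right)
qed

text \<open>
  A simplex \<open>\<Delta>\<^bsub>[i,\<dots>,j]\<^esub>\<close> that meets the interval without being contained in it has a vertex
  next to the interval, and there \<open>c\<close> is larger than on the interval.  So a point of this simplex
  that maximizes \<open>c\<close> has no mass in the interval.
\<close>
lemma max_face_in_interval_face:
  assumes lm: "valid_interval l m"
    and low: "\<And>k. k \<in> {l..m} \<Longrightarrow> c \<bullet> e k = t"
    and left: "l > 1 \<Longrightarrow> c \<bullet> e (l - 1) > t" and right: "m < n + 1 \<Longrightarrow> c \<bullet> e (m + 1) > t"
    and x: "x \<in> P" "\<forall>z\<in>P. c \<bullet> z \<le> c \<bullet> x"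
  shows "x \<in> interval_face l m"
proof -
  obtain y where y: "x = point_of y" "is_selection y" using x(1) P_eq by blast
  have I: "{l..m} \<subseteq> {1..n + 1}" using lm by auto
  have "coord_sum {l..m} (y (i, j)) = 0" if ij: "(i, j) \<in> summands" "\<not> {i..j} \<subseteq> {l..m}" for i j
  proof -
    let ?y = "y (i, j)"
    have J: "{i..j} \<subseteq> {1..n + 1}" "i \<le> j" using ij by (auto simp: summands_def)
    have yS: "?y \<in> simplex_interval e i j" using y(2) ij by (auto simp: is_selection_def)
    define M where "M = Max ((\<lambda>k. c \<bullet> e k) ` {i..j})"
    have M: "c \<bullet> e k \<le> M" if "k \<in> {i..j}" for k
      unfolding M_def using that by (intro Max_ge) auto
    have "M \<in> (\<lambda>k. c \<bullet> e k) ` {i..j}" unfolding M_def using J by (intro Max_in) auto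
    then obtain q where "q \<in> {i..j}" "c \<bullet> e q = M" by auto
    then have "M \<le> c \<bullet> ?y"
      using max_face_selection[OF y(2) _ ij(1), of c q] x(2) y(1) by auto
    also have "c \<bullet> ?y = (\<Sum>k\<in>{1..n + 1}. (?y \<bullet> e k) * (c \<bullet> e k))"
      using linear_fun_eq_inner[of c ?y] by (simp add: linear_fun_def mult.commute)
    also have "\<dots> = (\<Sum>k\<in>{i..j}. (?y \<bullet> e k) * (c \<bullet> e k))"
      using simplex_coords(2)[OF ij(1) yS] J by (intro sum.mono_neutral_right) auto
    \<comment> \<open>The weighted mean of the values \<open>c \<bullet> e k\<close> reaches their maximum \<open>M\<close>, so every vertex with
      a positive weight attains \<open>M\<close>.\<close>
    finally have "(\<Sum>k\<in>{i..j}. (?y \<bullet> e k) * (M - c \<bullet> e k)) \<le> 0"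
      using simplex_coords(3)[OF ij(1) yS]
      by (simp add: right_diff_distrib sum_subtractf coord_sum_def flip: sum_distrib_right)
    moreover have nn: "(?y \<bullet> e k) * (M - c \<bullet> e k) \<ge> 0" if "k \<in> {i..j}" for k
      using simplex_coords(1)[OF ij(1) yS, of k] M[OF that] that J by auto
    moreover have "(\<Sum>k\<in>{i..j}. (?y \<bullet> e k) * (M - c \<bullet> e k)) \<ge> 0"
      using nn by (rule sum_nonneg)
    ultimately have zero: "(?y \<bullet> e k) * (M - c \<bullet> e k) = 0" if "k \<in> {i..j}" for k
      using sum_nonneg_eq_0_iff[of "{i..j}" "\<lambda>k. (?y \<bullet> e k) * (M - c \<bullet> e k)"] that
      by (metis (no_types, lifting) antisym finite_atLeastAtMost)
    have "?y \<bullet> e k = 0" if k: "k \<in> {l..m}" for k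
    proof (cases "k \<in> {i..j}")
      case True
      have "t < M"
      proof -
        have "i < l \<or> m < j" using ij(2) by auto
        then show ?thesis
        proof
          assume "i < l"
          then have "l - 1 \<in> {i..j}" "l > 1" using True k J by auto
          then show ?thesis using M[of "l - 1"] left by force
        next
          assume "m < j"
          then have "m + 1 \<in> {i..j}" "m < n + 1" using True k J by auto
          then show ?thesis using M[of "m + 1"] right by force
        qed
      qed
      then show ?thesis using zero[OF True] low[OF k] by simp
    next
      case False
      then show ?thesis using simplex_coords(2)[OF ij(1) yS] k I by blast
    qed
    then show ?thesis by (simp add: coord_sum_def)
  qed
  then have "coord_sum {l..m} x = interval_mass {l..m}"
    unfolding y(1) by (rule coord_sum_eq_mass[OF y(2) I])
  then show ?thesis using x(1) by (simp add: interval_face_def)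
qed

text \<open>
  The run extends as far as possible to both sides of an index where the minimum is attained; the
  larger values next to it are what \<open>max_face_in_interval_face\<close> asks for.
\<close>
lemma minimal_run:
  fixes v :: "nat \<Rightarrow> real"
  assumes "\<exists>k\<in>{1..n + 1}. \<exists>q\<in>{1..n + 1}. v k \<noteq> v q"
  obtains l m t where "proper_interval l m" "\<And>k. k \<in> {l..m} \<Longrightarrow> v k = t"
    "l > 1 \<Longrightarrow> v (l - 1) > t" "m < n + 1 \<Longrightarrow> v (m + 1) > t"
proof -
  define t where "t = Min (v ` {1..n + 1})"
  have t: "t \<le> v k" if "k \<in> {1..n + 1}" for k
    unfolding t_def using that by (intro Min_le) auto
  have "t \<in> v ` {1..n + 1}" unfolding t_def by (intro Min_in) auto
  then obtain k0 where k0: "k0 \<in> {1..n + 1}" "v k0 = t" by auto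
  define l where "l = (LEAST l. 1 \<le> l \<and> l \<le> k0 \<and> (\<forall>k\<in>{l..k0}. v k = t))"
  have l: "1 \<le> l \<and> l \<le> k0 \<and> (\<forall>k\<in>{l..k0}. v k = t)"
    unfolding l_def by (rule LeastI[of _ k0]) (use k0 in auto)
  define m where "m = (GREATEST m. k0 \<le> m \<and> m \<le> n + 1 \<and> (\<forall>k\<in>{k0..m}. v k = t))"
  have m: "k0 \<le> m \<and> m \<le> n + 1 \<and> (\<forall>k\<in>{k0..m}. v k = t)"
    unfolding m_def by (rule GreatestI_nat[of _ k0 "n + 1"]) (use k0 in auto)
  have run: "v k = t" if "k \<in> {l..m}" for k
    using l m that by (cases "k \<le> k0") auto
  show ?thesis
  proof (rule that[of l m t])
    show "proper_interval l m"
    proof -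
      have "(l, m) \<noteq> (1, n + 1)"
      proof
        assume "(l, m) = (1, n + 1)"
        then have "\<forall>k\<in>{1..n + 1}. v k = t" using run by simp
        then show False using assms by auto
      qed
      then show ?thesis using l m by auto
    qed
    show "v (l - 1) > t" if "l > 1"
    proof (rule ccontr)
      assume "\<not> v (l - 1) > t"
      then have "v (l - 1) = t" using t[of "l - 1"] that l k0 by auto
      then have "v k = t" if "k \<in> {l - 1..k0}" for k
        using l that by (cases "k = l - 1") auto
      then have "1 \<le> l - 1 \<and> l - 1 \<le> k0 \<and> (\<forall>k\<in>{l - 1..k0}. v k = t)" using that l by auto
      then have "l \<le> l - 1" unfolding l_def by (rule Least_le)
      then show False using that by simp
    qed
    show "v (m + 1) > t" if "m < n + 1"
    proof (rule ccontr)
      assume "\<not> v (m + 1) > t"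
      then have "v (m + 1) = t" using t[of "m + 1"] that by auto
      then have "v k = t" if "k \<in> {k0..m + 1}" for k
        using m that by (cases "k = m + 1") auto
      then have "k0 \<le> m + 1 \<and> m + 1 \<le> n + 1 \<and> (\<forall>k\<in>{k0..m + 1}. v k = t)" using that m by auto
      then have "m + 1 \<le> m" unfolding m_def
        by (rule Greatest_le_nat[where b = "n + 1"]) auto
      then show False by simp
    qed
  qed (use run in auto)
qed

text \<open>
  A facet maximizes some linear function.  That function is not constant on the standard basis, since
  otherwise it would be a multiple of the coordinate sum and constant on the polytope.  So the facet
  lies in the interval face of a run of minimal weights, and two facets cannot be properly nested.
\<close>
lemma facet_is_interval_face:
  assumes F: "F facet_of P"
  obtains l m where "proper_interval l m" "F = interval_face l m"
proof -
  have "F exposed_face_of P"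
    using F polytope_P by (simp add: exposed_face_of_polyhedron polytope_imp_polyhedron facet_of_def)
  then obtain c b where cb: "P \<subseteq> {x. c \<bullet> x \<le> b}" "F = P \<inter> {x. c \<bullet> x = b}"
    by (auto simp: exposed_face_of_def)
  have max: "x \<in> P \<and> (\<forall>z\<in>P. c \<bullet> z \<le> c \<bullet> x)" if "x \<in> F" for x
    using that cb by auto
  obtain x0 where x0: "x0 \<in> F" using F by (auto simp: facet_of_def)
  have "\<exists>k\<in>{1..n + 1}. \<exists>q\<in>{1..n + 1}. c \<bullet> e k \<noteq> c \<bullet> e q"
  proof (rule ccontr)
    assume no: "\<not> ?thesis"
    have "1 \<in> {1..n + 1}" by simp
    then have const: "c \<bullet> e k = c \<bullet> e 1" if "k \<in> {1..n + 1}" for k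
      using that no by blast
    have lin: "c \<bullet> x = (c \<bullet> e 1) * coord_sum {1..n + 1} x" for x
      unfolding linear_fun_eq_inner[of c x, symmetric] linear_fun_def coord_sum_def sum_distrib_left
    proof (rule sum.cong[OF refl])
      fix k assume "k \<in> {1..n + 1}"
      then have "c \<bullet> e k = c \<bullet> e 1" by (rule const)
      then show "c \<bullet> e k * (x \<bullet> e k) = c \<bullet> e 1 * (x \<bullet> e k)" by (rule arg_cong)
    qed
    have "x0 \<in> P" using max[OF x0] by blast
    then have "c \<bullet> x = c \<bullet> x0" if "x \<in> P" for x
      unfolding lin[of x] lin[of x0] total_coord_sum[OF that] by (simp only: total_coord_sum)
    then have "F = P" using cb x0 by auto
    then show False using F by simp
  qed
  then obtain l m t where run: "proper_interval l m" "\<And>k. k \<in> {l..m} \<Longrightarrow> c \<bullet> e k = t"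
      "l > 1 \<Longrightarrow> c \<bullet> e (l - 1) > t" "m < n + 1 \<Longrightarrow> c \<bullet> e (m + 1) > t"
    using minimal_run[of "\<lambda>k. c \<bullet> e k"] by blast
  have "F \<subseteq> interval_face l m"
  proof
    fix x assume "x \<in> F"
    then show "x \<in> interval_face l m"
      using max_face_in_interval_face[of l m c t x] run max by blast
  qed
  then have "F = interval_face l m"
    using facets_subset_eq[OF _ F interval_face_facet[OF run(1)]] polytope_P
    by (simp add: polytope_imp_convex)
  then show ?thesis using that run(1) by blast
qed

section \<open>Parallel facets\<close>

text \<open>
  The vector \<open>e r - e s\<close> is a direction of an interval face exactly if \<open>r\<close> and \<open>s\<close> are both inside
  or both outside the interval.  Hence the direction space determines the partition of \<open>{1..n + 1}\<close>
  into the interval and its complement, and it is determined by that partition.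
\<close>
lemma directions_eq_iff:
  assumes I: "proper_interval l m" and J: "proper_interval l' m'"
  shows "directions (interval_face l m) = directions (interval_face l' m') \<longleftrightarrow>
    {l'..m'} = {l..m} \<or> {l'..m'} = {1..n + 1} - {l..m}"
proof
  have I': "{l..m} \<subseteq> {1..n + 1}" and J': "{l'..m'} \<subseteq> {1..n + 1}" using I J by auto
  {
    assume eq: "directions (interval_face l m) = directions (interval_face l' m')"
    have mem: "e r - e s \<in> directions (interval_face l m) \<longleftrightarrow> (r \<in> {l..m} \<longleftrightarrow> s \<in> {l..m})"
      if "valid_interval l m" "r \<in> {1..n + 1}" "s \<in> {1..n + 1}" for l m r s
    proof -
      have sub: "{l..m} \<subseteq> {1..n + 1}" using that(1) by auto
      show ?thesis
        unfolding directions_interval_face[OF that(1)] mem_Collect_eq coord_sum_linear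
          coord_sum_e[OF sub that(2)] coord_sum_e[OF sub that(3)]
          coord_sum_e[OF order_refl that(2)] coord_sum_e[OF order_refl that(3)]
        using that by auto
    qed
    have same: "(r \<in> {l..m} \<longleftrightarrow> l \<in> {l..m}) \<longleftrightarrow> (r \<in> {l'..m'} \<longleftrightarrow> l \<in> {l'..m'})"
      if "r \<in> {1..n + 1}" for r
      using mem[of l m r l] mem[of l' m' r l] eq that I J by auto
    have ll: "l \<in> {l..m}" using I by simp
    show "{l'..m'} = {l..m} \<or> {l'..m'} = {1..n + 1} - {l..m}"
    proof (cases "l \<in> {l'..m'}")
      case True
      then have "\<forall>r\<in>{1..n + 1}. r \<in> {l..m} \<longleftrightarrow> r \<in> {l'..m'}" using same ll by blast
      then show ?thesis using I' J' by blast
    next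
      case False
      then have "\<forall>r\<in>{1..n + 1}. r \<in> {l..m} \<longleftrightarrow> r \<notin> {l'..m'}" using same ll by blast
      then show ?thesis using I' J' by blast
    qed
  }
  assume "{l'..m'} = {l..m} \<or> {l'..m'} = {1..n + 1} - {l..m}"
  moreover have "coord_sum {1..n + 1} x = coord_sum ({1..n + 1} - {l..m}) x + coord_sum {l..m} x" for x
    unfolding coord_sum_def by (rule sum.subset_diff[OF I']) simp
  ultimately have "coord_sum {l..m} x = 0 \<and> coord_sum {1..n + 1} x = 0 \<longleftrightarrow>
      coord_sum {l'..m'} x = 0 \<and> coord_sum {1..n + 1} x = 0" for x
    by auto
  then show "directions (interval_face l m) = directions (interval_face l' m')"
    using directions_interval_face[of l m] directions_interval_face[of l' m'] I J by simp
qed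

text \<open>
  The summand \<open>\<Delta>\<^bsub>[1,\<dots>,n+1]\<^esub>\<close> is counted in neither part, and its parameter is positive.  Thus
  the faces of complementary intervals are disjoint, which separates parallel facets.
\<close>
lemma mass_superadditive:
  assumes "proper_interval l m"
  shows "interval_mass {l..m} + interval_mass ({1..n + 1} - {l..m}) < interval_mass {1..n + 1}"
proof -
  let ?I = "{l..m}" and ?J = "{1..n + 1} - {l..m}"
  have ind: "(if {i..j} \<subseteq> ?I then 1 else 0) + (if {i..j} \<subseteq> ?J then 1 else 0) \<le> (1::real)"
    if "(i, j) \<in> summands" for i j
  proof -
    have "i \<in> {i..j}" using that by (simp add: summands_def)
    then have "\<not> ({i..j} \<subseteq> ?I \<and> {i..j} \<subseteq> ?J)" by blast
    then show ?thesis by (auto simp del: atLeastatMost_subset_iff)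
  qed
  have all: "{i..j} \<subseteq> {1..n + 1}" if "(i, j) \<in> summands" for i j
    using that by (auto simp: summands_def)
  have full: "(1, n + 1) \<in> summands" by (simp add: summands_def)
  have l: "l \<in> {1..n + 1}" "l \<in> {l..m}" using assms by auto
  have "\<not> {1..n + 1} \<subseteq> ?I" using assms by auto
  moreover have "\<not> {1..n + 1} \<subseteq> ?J" using l by blast
  moreover have pos: "a i j > 0" if "(i, j) \<in> summands" for i j
    using that a_pos by (auto simp: summands_def)
  ultimately have "(\<Sum>(i, j)\<in>summands. a i j * ((if {i..j} \<subseteq> ?I then 1 else 0) + (if {i..j} \<subseteq> ?J then 1 else 0)))
      < (\<Sum>(i, j)\<in>summands. a i j * (if {i..j} \<subseteq> {1..n + 1} then 1 else 0))"
  proof (intro sum_strict_mono_ex1 finite_summands ballI bexI[OF _ full])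
    fix t assume t: "t \<in> summands"
    obtain i j where ij: "t = (i, j)" by (cases t)
    show "(case t of (i, j) \<Rightarrow> a i j * ((if {i..j} \<subseteq> ?I then 1 else 0) + (if {i..j} \<subseteq> ?J then 1 else 0)))
        \<le> (case t of (i, j) \<Rightarrow> a i j * (if {i..j} \<subseteq> {1..n + 1} then 1 else 0))"
      unfolding ij prod.case if_P[OF all[OF t[unfolded ij]]]
      using ind[OF t[unfolded ij]] pos[OF t[unfolded ij]] by (intro mult_left_mono) simp_all
  qed (use pos[OF full] in simp)
  then show ?thesis
    unfolding interval_mass_eq sum.distrib[symmetric] by (simp add: distrib_left case_prod_unfold)
qed

lemma interval_face_inj:
  assumes I: "proper_interval l m" and J: "proper_interval l' m'" and eq: "interval_face l m = interval_face l' m'"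
  shows "l = l' \<and> m = m'"
proof -
  have I': "{l..m} \<subseteq> {1..n + 1}" using I by auto
  have "{l'..m'} = {l..m} \<or> {l'..m'} = {1..n + 1} - {l..m}"
    using directions_eq_iff[OF I J] eq by simp
  moreover have "{l'..m'} \<noteq> {1..n + 1} - {l..m}"
  proof
    assume compl: "{l'..m'} = {1..n + 1} - {l..m}"
    obtain x where x: "x \<in> interval_face l m" using interval_face_nonempty I by blast
    have "coord_sum {1..n + 1} x = coord_sum ({1..n + 1} - {l..m}) x + coord_sum {l..m} x"
      unfolding coord_sum_def by (rule sum.subset_diff[OF I']) simp
    moreover have "coord_sum {l..m} x = interval_mass {l..m}"
      "coord_sum ({1..n + 1} - {l..m}) x = interval_mass ({1..n + 1} - {l..m})"
      using x x[unfolded eq] unfolding interval_face_def compl by simp_all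
    ultimately show False using mass_superadditive[OF I] total_coord_sum[of x] x
      by (simp add: interval_face_def)
  qed
  ultimately show ?thesis using I J by (simp add: Icc_eq_Icc)
qed

text \<open>
  One of the two intervals contains \<open>1\<close>, and the other one begins right after its end.
\<close>
lemma complementary_intervals:
  assumes I: "proper_interval l m" and J: "proper_interval l' m'"
  shows "{l'..m'} = {1..n + 1} - {l..m} \<longleftrightarrow>
    (\<exists>i\<in>{1..n}. (l, m) = (i + 1, n + 1) \<and> (l', m') = (1, i) \<or> (l, m) = (1, i) \<and> (l', m') = (i + 1, n + 1))"
    (is "_ \<longleftrightarrow> ?R")
proof
  assume compl: "{l'..m'} = {1..n + 1} - {l..m}"
  have mem: "k \<in> {l'..m'} \<longleftrightarrow> k \<notin> {l..m}" if "k \<in> {1..n + 1}" for k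
    using compl that by blast
  show ?R
  proof (cases "l = 1")
    case True
    then have m: "m \<le> n" using I by auto
    have "m + 1 \<in> {l'..m'}" "n + 1 \<in> {l'..m'}" using mem[of "m + 1"] mem[of "n + 1"] m by auto
    moreover have "m \<notin> {l'..m'}" using mem[of m] I by auto
    ultimately have "l' = m + 1" "m' = n + 1" using J by auto
    then show ?thesis using True m I by (intro bexI[of _ m]) auto
  next
    case False
    then have l: "1 < l" using I by auto
    have "l - 1 \<in> {1..n + 1}" "l - 1 \<notin> {l..m}" using l I by auto
    then have "l - 1 \<in> {l'..m'}" using mem[of "l - 1"] by blast
    moreover have "1 \<in> {l'..m'}" using mem[of 1] l I by auto
    moreover have "l \<notin> {l'..m'}" using mem[of l] I by auto
    ultimately have "l' = 1" "m' = l - 1" using J by auto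
    moreover have "m = n + 1"
    proof (rule ccontr)
      assume "m \<noteq> n + 1"
      then have "n + 1 \<in> {l'..m'}" using mem[of "n + 1"] I by auto
      then show False using \<open>m' = l - 1\<close> I by auto
    qed
    ultimately show ?thesis using l I by (intro bexI[of _ "l - 1"]) auto
  qed
next
  assume ?R
  then show "{l'..m'} = {1..n + 1} - {l..m}" by auto
qed

lemma parallel_facet_pairs_eq:
  "parallel_facet_pairs P = (\<lambda>i. {interval_face (i + 1) (n + 1), interval_face 1 i}) ` {1..n}"
proof (intro equalityI subsetI)
  fix X assume "X \<in> parallel_facet_pairs P"
  then obtain F G where X: "X = {F, G}" and par: "F facet_of P" "G facet_of P" "F \<noteq> G"
      "directions F = directions G"
    by (auto simp: parallel_facet_pairs_def parallel_facets_def)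
  obtain l m where F: "proper_interval l m" "F = interval_face l m"
    using facet_is_interval_face[OF par(1)] by blast
  obtain l' m' where G: "proper_interval l' m'" "G = interval_face l' m'"
    using facet_is_interval_face[OF par(2)] by blast
  have "{l'..m'} \<noteq> {l..m}"
    using par(3) F G by (auto simp: Icc_eq_Icc)
  then have "{l'..m'} = {1..n + 1} - {l..m}"
    using directions_eq_iff[OF F(1) G(1)] par(4) F(2) G(2) by blast
  then obtain i where i: "i \<in> {1..n}" "(l, m) = (i + 1, n + 1) \<and> (l', m') = (1, i) \<or>
      (l, m) = (1, i) \<and> (l', m') = (i + 1, n + 1)"
    using complementary_intervals[OF F(1) G(1)] by blast
  then have "X = {interval_face (i + 1) (n + 1), interval_face 1 i}"
    using X F(2) G(2) by auto
  then show "X \<in> (\<lambda>i. {interval_face (i + 1) (n + 1), interval_face 1 i}) ` {1..n}"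
    using i(1) by blast
next
  fix X assume "X \<in> (\<lambda>i. {interval_face (i + 1) (n + 1), interval_face 1 i}) ` {1..n}"
  then obtain i where i: "i \<in> {1..n}" and X: "X = {interval_face (i + 1) (n + 1), interval_face 1 i}"
    by blast
  have p: "proper_interval (i + 1) (n + 1)" "proper_interval 1 i" using i by auto
  have "directions (interval_face (i + 1) (n + 1)) = directions (interval_face 1 i)"
    using directions_eq_iff[OF p] complementary_intervals[OF p] i by blast
  moreover have "interval_face (i + 1) (n + 1) \<noteq> interval_face 1 i"
    using interval_face_inj[OF p] i by auto
  ultimately have "parallel_facets P (interval_face (i + 1) (n + 1)) (interval_face 1 i)"
    using interval_face_facet p by (simp add: parallel_facets_def)
  then show "X \<in> parallel_facet_pairs P" unfolding parallel_facet_pairs_def X by blast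
qed

lemma interval_pairs_inj:
  "inj_on (\<lambda>i. {interval_face (i + 1) (n + 1), interval_face 1 i}) {1..n}"
proof (rule inj_onI)
  fix i i' assume i: "i \<in> {1..n}" "i' \<in> {1..n}"
    and eq: "{interval_face (i + 1) (n + 1), interval_face 1 i} =
      {interval_face (i' + 1) (n + 1), interval_face 1 i'}"
  have p: "proper_interval (i' + 1) (n + 1)" "proper_interval 1 i" "proper_interval 1 i'" using i by auto
  have "interval_face 1 i = interval_face 1 i' \<or> interval_face 1 i = interval_face (i' + 1) (n + 1)"
    using eq by (auto simp: doubleton_eq_iff)
  then show "i = i'"
  proof
    assume "interval_face 1 i = interval_face 1 i'"
    then show ?thesis using interval_face_inj[OF p(2,3)] by simp
  next
    assume "interval_face 1 i = interval_face (i' + 1) (n + 1)"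
    then have "1 = i' + 1" using interval_face_inj[OF p(2,1)] by simp
    then show ?thesis using i by simp
  qed
qed

section \<open>Facets and diagonals\<close>

text \<open>
  On the polytope, a two-valued weight is a constant minus a positive multiple of the coordinate sum
  over the interval.
\<close>
lemma max_face_two_valued:
  assumes lm: "valid_interval l m"
    and w: "\<And>k. k \<in> {l..m} \<Longrightarrow> w k = s" "\<And>k. k \<in> {1..n + 1} - {l..m} \<Longrightarrow> w k = t" "s < t"
  shows "max_face n e P w = interval_face l m"
proof -
  have I: "{l..m} \<subseteq> {1..n + 1}" using lm by auto
  have lin: "linear_fun n e w x = t * interval_mass {1..n + 1} - (t - s) * coord_sum {l..m} x"
    if "x \<in> P" for x
  proof -
    have split: "(\<Sum>k\<in>{1..n + 1}. f k) = (\<Sum>k\<in>{1..n + 1} - {l..m}. f k) + (\<Sum>k\<in>{l..m}. f k)"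
      for f :: "nat \<Rightarrow> real"
      by (rule sum.subset_diff[OF I]) simp
    have "linear_fun n e w x = t * coord_sum ({1..n + 1} - {l..m}) x + s * coord_sum {l..m} x"
      unfolding linear_fun_def split coord_sum_def sum_distrib_left
      using w(1,2) by (intro arg_cong2[of _ _ _ _ "(+)"] sum.cong) simp_all
    moreover have total: "interval_mass {1..n + 1} = coord_sum ({1..n + 1} - {l..m}) x + coord_sum {l..m} x"
      unfolding total_coord_sum[OF that, symmetric] coord_sum_def by (rule split)
    ultimately show ?thesis unfolding total by (simp add: algebra_simps)
  qed
  have le: "linear_fun n e w y \<le> linear_fun n e w x \<longleftrightarrow> coord_sum {l..m} x \<le> coord_sum {l..m} y"
    if "x \<in> P" "y \<in> P" for x y
    using w(3) by (simp add: lin that)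
  obtain x0 where x0: "x0 \<in> interval_face l m" using interval_face_nonempty[OF lm] by blast
  show ?thesis
  proof (intro equalityI subsetI)
    fix x assume "x \<in> max_face n e P w"
    then have "x \<in> P" "coord_sum {l..m} x \<le> coord_sum {l..m} x0"
      using le x0 by (auto simp: max_face_def interval_face_def)
    then show "x \<in> interval_face l m"
      using interval_mass_le[OF _ I, of x] x0 by (auto simp: interval_face_def)
  next
    fix x assume "x \<in> interval_face l m"
    then show "x \<in> max_face n e P w"
      using le interval_mass_le[OF _ I] by (auto simp: max_face_def interval_face_def)
  qed
qed

text \<open>
  The weight \<open>-1\<close> on the interval and \<open>0\<close> elsewhere has the given diagonal as its subdivision, and
  every other weight with this subdivision is two-valued in the same way and so has the same face.
\<close>
lemma diagonal_facet_eq: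
  assumes p: "convex_polygon_ccw n p" and n: "n \<ge> 1" and lm: "proper_interval l m"
  shows "diagonal_facet n e a p {l - 1, m + 1} = interval_face l m"
  unfolding diagonal_facet_def
proof (rule the_equality)
  have "subdivision n p (\<lambda>k. if k \<in> {l..m} then - 1 else 0) = {{l - 1, m + 1}}"
    by (rule subdivision_two_valued[OF p n, of l m _ "- 1" 0]) (use lm in auto)
  moreover have "max_face n e P (\<lambda>k. if k \<in> {l..m} then - 1 else 0) = interval_face l m"
    by (rule max_face_two_valued[of l m _ "- 1" 0]) (use lm in auto)
  ultimately show "\<exists>w. interval_face l m = max_face n e P w \<and> subdivision n p w = {{l - 1, m + 1}}"
    by metis
next
  fix F assume "\<exists>w. F = max_face n e P w \<and> subdivision n p w = {{l - 1, m + 1}}"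
  then obtain w where F: "F = max_face n e P w" and sub: "subdivision n p w = {{l - 1, m + 1}}"
    by blast
  have bounds: "1 \<le> l" "l \<le> m" "m \<le> n + 1" "(l, m) \<noteq> (1, n + 1)" using lm by auto
  obtain s t where "\<And>k. k \<in> {l..m} \<Longrightarrow> w k = s" "\<And>k. k \<in> {1..n + 1} - {l..m} \<Longrightarrow> w k = t" "s < t"
    using single_diagonal_two_valued[OF p n bounds sub] by blast
  then show "F = interval_face l m" unfolding F using lm by (intro max_face_two_valued) auto
qed

end

theorem theorem2p16:
  fixes n :: nat
    and e :: "nat \<Rightarrow> 'a::euclidean_space"
    and a :: "nat \<Rightarrow> nat \<Rightarrow> real"
    and p :: "nat \<Rightarrow> complex"
  assumes "n \<ge> 1"
    and "bij_betw e {1..n + 1} Basis"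
    and "\<And>i j. 1 \<le> i \<Longrightarrow> i \<le> j \<Longrightarrow> j \<le> n + 1 \<Longrightarrow> a i j > 0"
    and "convex_polygon_ccw n p"
  shows "card (parallel_facet_pairs (assIII n e a)) = n \<and>
         bij_betw (\<lambda>i. {diagonal_facet n e a p {n + 2, i}, diagonal_facet n e a p {0, i + 1}})
           {1..n} (parallel_facet_pairs (assIII n e a))"
proof -
  interpret minkowski_associahedron n e a
    using assms(2,3) by unfold_locales
  let ?pair = "\<lambda>i. {interval_face (i + 1) (n + 1), interval_face 1 i}"
  have bij: "bij_betw ?pair {1..n} (parallel_facet_pairs P)"
    unfolding bij_betw_def using interval_pairs_inj parallel_facet_pairs_eq by simp
  have "{diagonal_facet n e a p {n + 2, i}, diagonal_facet n e a p {0, i + 1}} = ?pair i"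
    if i: "i \<in> {1..n}" for i
  proof -
    have "{n + 2, i} = {(i + 1) - 1, (n + 1) + 1}" "{0, i + 1} = {1 - 1, i + 1}" by auto
    moreover have "proper_interval (i + 1) (n + 1)" "proper_interval 1 i" using i by auto
    ultimately show ?thesis
      using diagonal_facet_eq[OF assms(4,1)] by presburger
  qed
  then have "bij_betw (\<lambda>i. {diagonal_facet n e a p {n + 2, i}, diagonal_facet n e a p {0, i + 1}})
      {1..n} (parallel_facet_pairs P)"
    using bij by (subst bij_betw_cong)
  then show ?thesis using bij_betw_same_card[OF bij] by simp
qed

end
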